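(* (1) For all positive integers $d,n$ with $d+1\le n\le 2^d$ we have $g_{\mathrm{nfac}}(d,n)\le 3d$. (2) For $d+1\le n(d)\le 2^{o(d)}$ we have $g_{\mathrm{nfac}}(d,n(d))=d+o(d)$. (3) For every real $\alpha$ with $1<\alpha<2$ and $n(d):=\lfloor\alpha^d\rfloor$ we have $g_{\mathrm{nfac}}(d,n(d))\le(1+2\log_2\alpha)d+o(d)$.
   Context: A 0/1-polytope is the convex hull of a set of points in $\{0,1\}^m$ for some $m$. For $d,n\in\mathbb{N}$ with $d+1\le n\le 2^d$, $g_{\mathrm{nfac}}(d,n)$ denotes the minimal number of facets of a $d$-dimensional 0/1-polytope with exactly $n$ vertices (this does not depend on the ambient dimension $m\geq d$, since a $d$-dimensional 0/1-polytope in $\mathbb{R}^m$ can be projected to an affinely isomorphic 0/1-polytope in $\mathbb{R}^d$). The $o(d)$ terms are asymptotic as $d\to\infty$: in (2), $n(\cdot)$ is an integer-valued function with $d+1\le n(d)\le 2^d$ and $\log_2 n(d)=o(d)$; in (3), the statement concerns $d$ large enough that $d+1\le\lfloor\alpha^d\rfloor\le 2^d$. *)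

theory Defs
  imports "HOL-Analysis.Analysis" "HOL-Analysis.Finite_Function_Topology" "HOL-Library.Landau_Symbols"
begin

text \<open>
  The dimension has to range over the natural numbers inside a single statement, so all spaces
  \<open>\<real>\<^sup>m\<close> live in one real vector space: the type of finitely supported sequences, where \<open>\<real>\<^sup>m\<close> is
  the subspace of sequences supported on \<open>{..<m}\<close>. That type is a \<^class>\<open>real_normed_vector\<close> but not a
  \<^class>\<open>euclidean_space\<close>. Hence \<^const>\<open>face_of\<close>, \<^const>\<open>extreme_point_of\<close> and convex hulls are used
  directly, while \<^const>\<open>aff_dim\<close> and \<^const>\<open>facet_of\<close>, which are restricted to Euclidean space
  types, are restated below for arbitrary real vector spaces.
\<close>

text \<open>
  Unlike in \<^const>\<open>aff_dim\<close>, the affine basis must be explicitly finite, since \<^const>\<open>card\<close> is 0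
  on infinite sets. The value is unspecified if \<open>S\<close> has no finite affine basis, and it is \<open>-1\<close> if
  \<open>S\<close> is empty.
\<close>

definition affine_dim :: "'a::real_vector set \<Rightarrow> int" where
  "affine_dim S =
    (SOME d. \<exists>B. finite B \<and> affine hull B = affine hull S \<and> \<not> affine_dependent B
                \<and> of_nat (card B) = d + 1)"

definition is_facet_of :: "'a::real_vector set \<Rightarrow> 'a set \<Rightarrow> bool" where
  "is_facet_of F P \<longleftrightarrow> F face_of P \<and> F \<noteq> {} \<and> affine_dim F = affine_dim P - 1"

definition zero_one_points :: "nat \<Rightarrow> (nat \<Rightarrow>\<^sub>0 real) set" where
  "zero_one_points m =
    {v. (\<forall>i<m. Poly_Mapping.lookup v i \<in> {0, 1}) \<and> (\<forall>i\<ge>m. Poly_Mapping.lookup v i = 0)}"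

definition zero_one_polytope :: "nat \<Rightarrow> (nat \<Rightarrow>\<^sub>0 real) set \<Rightarrow> bool" where
  "zero_one_polytope m P \<longleftrightarrow> (\<exists>V. V \<subseteq> zero_one_points m \<and> P = convex hull V)"

text \<open>
  The minimum is over a nonempty set exactly when \<open>d + 1 \<le> n \<le> 2 ^ d\<close>; outside this range the
  \<open>LEAST\<close> is unspecified.
\<close>

definition g_nfac :: "nat \<Rightarrow> nat \<Rightarrow> nat" where
  "g_nfac d n =
    (LEAST k. \<exists>m P. zero_one_polytope m P \<and> affine_dim P = int d
                   \<and> card {v. v extreme_point_of P} = n
                   \<and> card {F. is_facet_of F P} = k)"

end

theory Submission
  imports Defs "HOL-Real_Asymp.Real_Asymp"
begin

text \<open>
  The upper bounds come from one family of polytopes. The convex hull of the first \<open>n\<close> points of the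
  cube \<open>{0,1}\<^sup>k\<close> in lexicographic order is described by the \<open>2 k\<close> cube inequalities and at most \<open>k\<close>
  cover inequalities, one for each 0 in the binary expansion of \<open>n - 1\<close>
  (\<open>lex_points_decomposition\<close>). So it has at most \<open>3 k\<close> facets, and it is full-dimensional if
  \<open>2 ^ (k - 1) < n\<close>. Each pyramid over a 0/1-polytope adds one dimension, one vertex and one facet.
  Given \<open>d\<close> and \<open>n\<close>, take \<open>d - k\<close> pyramids over a lexicographic polytope of dimension \<open>k\<close> with
  \<open>n - (d - k)\<close> vertices, for the smallest possible \<open>k\<close> (\<open>zero_one_polytope_exists\<close>). The result has
  dimension \<open>d\<close>, \<open>n\<close> vertices and at most \<open>3 k + (d - k) = d + 2 k\<close> facets, where \<open>k \<le> d\<close> and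
  \<open>k \<le> \<lceil>log 2 n\<rceil>\<close>. The first inequality gives \<open>3 d\<close>, the second one \<open>d + 2 log 2 n + 2\<close>, which
  is \<open>d + o(d)\<close> for subexponential \<open>n\<close> and \<open>(1 + 2 log 2 \<alpha>) d + 2\<close> for \<open>n = \<lfloor>\<alpha> ^ d\<rfloor>\<close>.

  The asymptotic equality for subexponential \<open>n\<close> also needs a lower bound, namely that a
  \<open>d\<close>-dimensional polytope has at least \<open>d + 1\<close> facets if \<open>d > 0\<close>
  (\<open>card_facets_ge_dim_plus_one\<close>): the affine functionals that define facets generate the cone of
  all nonnegative affine functionals, and therefore span the space of all affine functionals, which
  has dimension \<open>d + 1\<close>.

  Two facts connect facets and functionals. A description of a polytope by inequalities contains
  an inequality for each facet (\<open>card_facets_le_card_inequalities\<close>), and conversely a nonnegative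
  functional that its zeros among the vertices determine up to scaling defines a facet
  (\<open>maximal_zero_set_is_facet\<close>). Both are proved for arbitrary real vector spaces, with
  barycenters of finite sets of vertices in the role of relative interior points.
\<close>

section \<open>Affine functionals and affine bases\<close>

text \<open>
  Real affine functionals, as plain functions. They take the role of normal vectors,
  since a general real vector space has no inner product.
\<close>

definition affine_functional :: "('a::real_vector \<Rightarrow> real) \<Rightarrow> bool" where
  "affine_functional h \<longleftrightarrow> (\<exists>f c. linear f \<and> h = (\<lambda>x. f x + c))"

lemma affine_functional_const: "affine_functional (\<lambda>x. c)"
  unfolding affine_functional_def
  by (rule exI[of _ "\<lambda>x. 0"], rule exI[of _ c]) (auto intro: linearI)

lemma affine_functional_add:
  assumes "affine_functional g" "affine_functional h"
  shows "affine_functional (\<lambda>x. g x + h x)"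
proof -
  obtain f c f' c' where "linear f" "g = (\<lambda>x. f x + c)" "linear f'" "h = (\<lambda>x. f' x + c')"
    using assms unfolding affine_functional_def by blast
  then have "linear (\<lambda>x. f x + f' x)" "(\<lambda>x. g x + h x) = (\<lambda>x. (f x + f' x) + (c + c'))"
    by (auto intro: linear_compose_add)
  then show ?thesis unfolding affine_functional_def by blast
qed

lemma affine_functional_cmult:
  assumes "affine_functional g"
  shows "affine_functional (\<lambda>x. a * g x)"
proof -
  obtain f c where "linear f" "g = (\<lambda>x. f x + c)"
    using assms unfolding affine_functional_def by blast
  then have "linear (\<lambda>x. a *\<^sub>R f x)" "(\<lambda>x. a * g x) = (\<lambda>x. a *\<^sub>R f x + a * c)"
    by (auto simp: linear_iff algebra_simps)
  then show ?thesis unfolding affine_functional_def by blast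
qed

lemma affine_functional_diff:
  assumes "affine_functional g" "affine_functional h"
  shows "affine_functional (\<lambda>x. g x - h x)"
  using affine_functional_add[OF assms(1) affine_functional_cmult[OF assms(2), of "-1"]] by simp

lemma affine_functional_sum:
  assumes "\<And>i. i \<in> I \<Longrightarrow> affine_functional (g i)"
  shows "affine_functional (\<lambda>x. \<Sum>i\<in>I. g i x)"
  using assms
  by (induction I rule: infinite_finite_induct)
    (auto intro: affine_functional_add affine_functional_const)

lemma affine_functional_combination:
  assumes "affine_functional h" "u + v = 1"
  shows "h (u *\<^sub>R x + v *\<^sub>R y) = u * h x + v * h y"
proof -
  obtain f c where f: "linear f" "h = (\<lambda>x. f x + c)"
    using assms unfolding affine_functional_def by blast
  have "c = (u + v) * c"
    using assms by simp
  then show ?thesis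
    by (simp add: f linear_add linear_scale algebra_simps)
qed

lemma affine_functional_sum_combination:
  assumes "affine_functional h" "finite S" "sum u S = 1"
  shows "h (\<Sum>v\<in>S. u v *\<^sub>R v) = (\<Sum>v\<in>S. u v * h v)"
proof -
  obtain f c where f: "linear f" "h = (\<lambda>x. f x + c)"
    using assms unfolding affine_functional_def by blast
  have "(\<Sum>v\<in>S. u v * h v) = (\<Sum>v\<in>S. u v * f v) + sum u S * c"
    by (simp add: f(2) algebra_simps sum.distrib sum_distrib_left)
  then show ?thesis
    by (simp add: f assms linear_sum linear_scale)
qed

lemma affine_functional_eq_on_affine_hull:
  assumes "affine_functional g" "affine_functional h" "\<And>x. x \<in> S \<Longrightarrow> g x = h x" "x \<in> affine hull S"
  shows "g x = h x"
proof -
  have "affine {x. g x = h x}"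
    unfolding affine_def using assms(1,2) by (simp add: affine_functional_combination)
  then have "affine hull S \<subseteq> {x. g x = h x}"
    using assms(3) by (intro hull_minimal) auto
  then show ?thesis using assms(4) by auto
qed

lemma affine_functional_nonneg_on_convex_hull:
  assumes "affine_functional h" "\<And>x. x \<in> S \<Longrightarrow> 0 \<le> h x" "x \<in> convex hull S"
  shows "0 \<le> h x"
proof -
  have "convex {x. 0 \<le> h x}"
    unfolding convex_def using assms(1) by (simp add: affine_functional_combination)
  then have "convex hull S \<subseteq> {x. 0 \<le> h x}"
    using assms(2) by (intro hull_minimal) auto
  then show ?thesis using assms(3) by auto
qed

text \<open>
  An affine basis gives affine coordinates, so values on it can be prescribed freely. This
  takes the place of separation theorems.
\<close>

lemma affine_functional_extend:
  fixes u :: "'a::real_vector \<Rightarrow> real"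
  assumes "\<not> affine_dependent B"
  obtains h where "affine_functional h" "\<And>b. b \<in> B \<Longrightarrow> h b = u b"
proof (cases "B = {}")
  case True
  then show ?thesis using that affine_functional_const by blast
next
  case False
  then obtain a where a: "a \<in> B" by blast
  then have "independent ((\<lambda>x. -a + x) ` (B - {a}))"
    using assms affine_dependent_iff_dependent2 by blast
  then obtain g where g: "linear g"
      "\<And>x. x \<in> (\<lambda>x. -a + x) ` (B - {a}) \<Longrightarrow> g x = u (a + x) - u a"
    using linear_independent_extend[where f = "\<lambda>x. u (a + x) - u a"] by blast
  define h where "h = (\<lambda>x. g x + (u a - g a))"
  have "affine_functional h"
    unfolding affine_functional_def h_def using g(1) by blast
  moreover have "h b = u b" if "b \<in> B" for b
  proof (cases "b = a")
    case False
    then have "g (-a + b) = u b - u a" using g(2)[of "-a + b"] that by auto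
    moreover have "g (-a + b) = g b - g a"
      using linear_diff[OF g(1), of b a] by simp
    ultimately show ?thesis by (simp add: h_def)
  qed (simp add: h_def)
  ultimately show ?thesis using that by blast
qed

lemma affine_independent_insertI:
  assumes "\<not> affine_dependent S" "a \<notin> affine hull S"
  shows "\<not> affine_dependent (insert a S)"
proof -
  obtain T where T: "\<not> affine_dependent T" "S \<subseteq> T" "T \<subseteq> insert a S"
      "affine hull T = affine hull (insert a S)"
    using extend_to_affine_basis[OF assms(1), of "insert a S"] by blast
  then have "a \<in> T"
    using assms(2) hull_inc[of a "insert a S" affine] by (metis insertI1 subset_antisym subset_insert)
  then have "T = insert a S" using T by blast
  then show ?thesis using T by simp
qed

text \<open>
  Steinitz exchange for affine hulls: subtracting a base point turns the claim into the bound
  of independent sets by spanning sets.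
\<close>

lemma affine_independent_card_le:
  assumes "finite C" "\<not> affine_dependent B" "B \<subseteq> affine hull C"
  shows "finite B \<and> card B \<le> card C"
proof (cases "B = {}")
  case False
  then obtain b where b: "b \<in> B" by blast
  then have "C \<noteq> {}" using assms(3) by auto
  then obtain c where c: "c \<in> C" by blast
  let ?C = "(\<lambda>x. -c + x) ` (C - {c})" and ?B = "(\<lambda>x. -b + x) ` (B - {b})"
  have C: "affine hull C = (\<lambda>x. c + x) ` span ?C"
    by (rule affine_hull_span2[OF c])
  have "-b + x \<in> span ?C" if "x \<in> B" for x
  proof -
    have "x \<in> (\<lambda>x. c + x) ` span ?C" "b \<in> (\<lambda>x. c + x) ` span ?C"
      using that b assms(3) unfolding C by auto
    then obtain y z where "y \<in> span ?C" "z \<in> span ?C" "x = c + y" "b = c + z"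
      by blast
    then show ?thesis using span_diff[of y ?C z] by simp
  qed
  then have "?B \<subseteq> span ?C" by blast
  moreover have "independent ?B"
    using assms(2) affine_dependent_iff_dependent2[OF b] by blast
  ultimately have "finite ?B \<and> card ?B \<le> card ?C"
    using independent_span_bound[of ?C ?B] assms(1) by blast
  moreover have "card ?B = card (B - {b})" "card ?C = card (C - {c})"
    by (auto intro!: card_image simp: inj_on_def)
  moreover have "finite ?B \<longleftrightarrow> finite (B - {b})"
    by (rule finite_image_iff) (auto simp: inj_on_def)
  ultimately show ?thesis
    using b c assms(1) by (auto simp: card_Diff_singleton card_gt_0_iff)
       (metis Suc_pred card_gt_0_iff empty_iff Suc_le_mono)
qed simp

text \<open>
  Any two finite affine bases have the same cardinality, so the choice in the definition of
  \<^const>\<open>affine_dim\<close> is irrelevant and one affine basis suffices to compute it.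
\<close>

lemma affine_dim_eq_card:
  assumes "finite B" "\<not> affine_dependent B" "affine hull B = affine hull S"
  shows "affine_dim S = int (card B) - 1"
  unfolding affine_dim_def
proof (rule some_equality)
  fix d :: int
  assume "\<exists>B. finite B \<and> affine hull B = affine hull S \<and> \<not> affine_dependent B
      \<and> of_nat (card B) = d + 1"
  then obtain C where C: "finite C" "affine hull C = affine hull S" "\<not> affine_dependent C"
      "int (card C) = d + 1"
    by blast
  then have "card B = card C"
    using affine_independent_card_le[of C B] affine_independent_card_le[of B C] assms
    by (metis hull_subset order_antisym)
  then show "d = int (card B) - 1" using C by simp
qed (use assms in auto)

section \<open>Facets and valid inequalities\<close>

text \<open>
  If the segment from \<open>x\<close> to a point \<open>c\<close> of the face can be prolonged beyond \<open>c\<close> inside \<open>P\<close>,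
  then \<open>c\<close> is interior to a segment of \<open>P\<close> starting at \<open>x\<close>, which the face must then contain.
\<close>

lemma face_of_absorbs:
  assumes F: "F face_of P" and "x \<in> P" "c \<in> F" "0 < e" "c + e *\<^sub>R (c - x) \<in> P"
  shows "x \<in> F"
proof (cases "x = c")
  case False
  define y where "y = c + e *\<^sub>R (c - x)"
  define t where "t = 1 / (1 + e)"
  have t: "0 < t" "t < 1" "t * (1 + e) = 1" using assms by (auto simp: t_def)
  have "(1 - t) *\<^sub>R x + t *\<^sub>R y = (1 - t * (1 + e)) *\<^sub>R x + (t * (1 + e)) *\<^sub>R c"
    by (simp add: y_def algebra_simps)
  then have "c = (1 - t) *\<^sub>R x + t *\<^sub>R y" using t by simp
  moreover have "x \<noteq> y"
  proof
    assume "x = y"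
    then have "(1 + e) *\<^sub>R (c - x) = 0" by (simp add: y_def algebra_simps)
    then show False using False assms by auto
  qed
  ultimately have "c \<in> open_segment x y" using t by (auto simp: in_segment)
  then show ?thesis using F assms unfolding face_of_def y_def by blast
qed (use assms in simp)

lemma convex_combination_in_convex_hull:
  assumes "finite V" "\<And>v. v \<in> V \<Longrightarrow> 0 \<le> u v" "sum u V = 1"
  shows "(\<Sum>v\<in>V. u v *\<^sub>R v) \<in> convex hull V"
  unfolding convex_hull_finite[OF assms(1)]
  by (rule CollectI, rule exI[of _ u]) (use assms in simp)

text \<open>
  A point of \<open>F\<close> is a convex combination of \<open>V\<close>. From this point one can move a little away
  from each \<open>v\<close> of positive weight without leaving the hull, so every such \<open>v\<close> belongs to \<open>F\<close>.
\<close>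

lemma face_of_convex_hull_finite_eq:
  assumes V: "finite V" and F: "F face_of convex hull V"
  shows "F = convex hull (F \<inter> V)"
proof
  show "convex hull (F \<inter> V) \<subseteq> F"
    using face_of_imp_convex[OF F] by (intro hull_minimal) auto
  show "F \<subseteq> convex hull (F \<inter> V)"
  proof
    fix x assume x: "x \<in> F"
    then have "x \<in> convex hull V" using face_of_imp_subset[OF F] by blast
    then obtain u where u: "\<And>v. v \<in> V \<Longrightarrow> 0 \<le> u v" "sum u V = 1" "(\<Sum>v\<in>V. u v *\<^sub>R v) = x"
      using convex_hull_finite[OF V] by auto
    have *: "v \<in> F" if v: "v \<in> V" "u v \<noteq> 0" for v
    proof (cases "u v = 1")
      case True
      then have "sum u (V - {v}) = 0" using u(2) V v by (simp add: sum_diff1)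
      then have "\<And>w. w \<in> V - {v} \<Longrightarrow> u w = 0"
        using u(1) V by (subst (asm) sum_nonneg_eq_0_iff) auto
      then have "x = v"
        using u(3) V v True by (simp add: sum.remove[of V v])
      then show ?thesis using x by simp
    next
      case False
      have pos: "0 < u v" using u(1)[OF v(1)] v by simp
      have le: "u v \<le> 1" using u V v member_le_sum[of v V u] by auto
      \<comment> \<open>The largest step away from \<open>v\<close> that keeps the weight of \<open>v\<close> nonnegative.\<close>
      define e where "e = u v / (1 - u v)"
      have e: "0 < e" "e * (1 - u v) = u v" using pos le False by (auto simp: e_def)
      have "(\<Sum>w\<in>V. (u w + e * (u w - of_bool (w = v))) *\<^sub>R w) \<in> convex hull V"
      proof -
        have "0 \<le> u w + e * (u w - of_bool (w = v))" if "w \<in> V" for w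
        proof (cases "w = v")
          case True
          then show ?thesis using e(2) by (simp add: algebra_simps)
        qed (use u(1)[OF that] e(1) in simp)
        moreover have "(\<Sum>w\<in>V. u w + e * (u w - of_bool (w = v))) = 1"
          using u(2) V v
          by (simp add: sum.distrib sum_distrib_left[symmetric] sum_subtractf of_bool_def sum.delta')
        ultimately show ?thesis by (rule convex_combination_in_convex_hull[OF V])
      qed
      moreover have "(\<Sum>w\<in>V. (u w + e * (u w - of_bool (w = v))) *\<^sub>R w) = x + e *\<^sub>R (x - v)"
      proof -
        have "(\<Sum>w\<in>V. of_bool (w = v) *\<^sub>R w) = (\<Sum>w\<in>V. if w = v then w else 0)"
          by (intro sum.cong) auto
        also have "\<dots> = v" using V v by (simp add: sum.delta)
        finally have d: "(\<Sum>w\<in>V. of_bool (w = v) *\<^sub>R w) = v" .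
        have "(\<Sum>w\<in>V. (u w + e * (u w - of_bool (w = v))) *\<^sub>R w)
            = (\<Sum>w\<in>V. u w *\<^sub>R w + e *\<^sub>R (u w *\<^sub>R w - of_bool (w = v) *\<^sub>R w))"
          by (intro sum.cong) (simp_all add: algebra_simps)
        also have "\<dots> = x + e *\<^sub>R (x - v)"
          by (simp only: sum.distrib scaleR_sum_right[symmetric] sum_subtractf d u(3))
        finally show ?thesis .
      qed
      ultimately have "x + e *\<^sub>R (x - v) \<in> convex hull V" by simp
      then show ?thesis
        using face_of_absorbs[OF F hull_inc[OF v(1)] x e(1)] by blast
    qed
    have "(\<Sum>v\<in>F \<inter> V. u v *\<^sub>R v) = x"
      unfolding u(3)[symmetric] using * V by (intro sum.mono_neutral_left) auto
    moreover have "sum u (F \<inter> V) = 1"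
      unfolding u(2)[symmetric] using * V by (intro sum.mono_neutral_left) auto
    ultimately show "x \<in> convex hull (F \<inter> V)"
      using u(1) convex_combination_in_convex_hull[of "F \<inter> V" u] V by auto
  qed
qed

lemma finite_faces_convex_hull:
  assumes "finite V"
  shows "finite {F. F face_of convex hull V}"
proof (rule finite_subset)
  show "{F. F face_of convex hull V} \<subseteq> (\<lambda>W. convex hull W) ` Pow V"
    using face_of_convex_hull_finite_eq[OF assms] by blast
qed (use assms in simp)

definition barycenter :: "'a::real_vector set \<Rightarrow> 'a" where
  "barycenter W = (\<Sum>w\<in>W. (1 / real (card W)) *\<^sub>R w)"

lemma barycenter_in_convex_hull:
  assumes "finite W" "W \<noteq> {}"
  shows "barycenter W \<in> convex hull W"
proof -
  have "(\<Sum>w\<in>W. 1 / real (card W)) = 1" using assms by simp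
  then show ?thesis
    unfolding barycenter_def by (intro convex_combination_in_convex_hull assms) auto
qed

lemma affine_functional_barycenter:
  assumes "finite W" "W \<noteq> {}" "affine_functional h"
  shows "h (barycenter W) = (\<Sum>w\<in>W. h w) / real (card W)"
  unfolding barycenter_def
  using affine_functional_sum_combination[OF assms(3,1), of "\<lambda>w. 1 / real (card W)"] assms(1,2)
  by (simp add: sum_divide_distrib)

text \<open>
  The barycenter of the vertices of a face is a relative interior point of the face: from it one
  can move a little in any direction of the affine hull.
\<close>

lemma face_of_convex_hull_Int_affine_hull:
  assumes V: "finite V" and F: "F face_of convex hull V"
    and x: "x \<in> convex hull V" "x \<in> affine hull F"
  shows "x \<in> F"
proof -
  define W where "W = F \<inter> V"
  have W: "finite W" "F = convex hull W"
    using V F face_of_convex_hull_finite_eq unfolding W_def by auto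
  then have "x \<in> affine hull W" using x by (simp add: affine_hull_convex_hull)
  then obtain u where u: "sum u W = 1" "(\<Sum>w\<in>W. u w *\<^sub>R w) = x"
    using affine_hull_finite[OF W(1)] by auto
  then have ne: "W \<noteq> {}" by auto
  define p where "p = 1 / real (card W)"
  have p: "0 < p" "(\<Sum>w\<in>W. p) = 1" using ne W(1) by (auto simp: p_def card_gt_0_iff)
  define M where "M = (\<Sum>w\<in>W. \<bar>u w\<bar>)"
  \<comment> \<open>Small enough for all weights at once: \<open>M\<close> bounds each \<open>u w\<close>.\<close>
  define e where "e = p / (1 + M)"
  have M: "0 \<le> M" by (simp add: M_def sum_nonneg)
  have e: "0 < e" using p M by (simp add: e_def)
  have c0: "0 \<le> p + e * (p - u w)" if "w \<in> W" for w
  proof -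
    have "\<bar>u w\<bar> \<le> M" using that W(1) unfolding M_def by (intro member_le_sum) auto
    then have "e * u w \<le> e * (1 + M)" using e by (intro mult_left_mono) auto
    also have "\<dots> = p" using M by (simp add: e_def)
    finally have "e * u w \<le> p" .
    moreover have "0 < e * p" using e p(1) by (rule mult_pos_pos)
    moreover have "e * (p - u w) = e * p - e * u w" by (simp add: algebra_simps)
    ultimately show ?thesis using p(1) by linarith
  qed
  have c1: "(\<Sum>w\<in>W. p + e * (p - u w)) = 1"
    by (simp only: sum.distrib sum_distrib_left[symmetric] sum_subtractf p(2) u(1)) simp
  have "(\<Sum>w\<in>W. (p + e * (p - u w)) *\<^sub>R w) = barycenter W + e *\<^sub>R (barycenter W - x)"
  proof -
    have "(\<Sum>w\<in>W. (p + e * (p - u w)) *\<^sub>R w)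
        = (\<Sum>w\<in>W. p *\<^sub>R w + e *\<^sub>R (p *\<^sub>R w - u w *\<^sub>R w))"
      by (intro sum.cong) (simp_all add: algebra_simps)
    also have "\<dots> = barycenter W + e *\<^sub>R (barycenter W - x)"
      unfolding barycenter_def p_def[symmetric]
      by (simp only: sum.distrib scaleR_sum_right[symmetric] sum_subtractf u(2))
    finally show ?thesis .
  qed
  then have "barycenter W + e *\<^sub>R (barycenter W - x) \<in> convex hull W"
    using convex_combination_in_convex_hull[OF W(1) c0 c1] by simp
  then have "barycenter W + e *\<^sub>R (barycenter W - x) \<in> convex hull V"
    using face_of_imp_subset[OF F] W(2) by blast
  then show ?thesis
    using face_of_absorbs[OF F x(1) _ e] barycenter_in_convex_hull[OF W(1) ne] W(2) by blast
qed

lemma affine_basis_finite: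
  assumes "finite V"
  obtains B where "B \<subseteq> V" "finite B" "\<not> affine_dependent B" "affine hull B = affine hull V"
    "affine_dim V = int (card B) - 1"
  using affine_basis_exists[of V] affine_dim_eq_card[of _ V] assms
  by (metis finite_subset)

lemma affine_dim_convex_hull: "affine_dim (convex hull V) = affine_dim V"
  by (simp add: affine_dim_def affine_hull_convex_hull)

text \<open>
  If no nontrivial inequality were tight on all of \<open>F\<close>, all nontrivial ones would be strict at
  the barycenter of \<open>F\<close>. One could then move from it away from any vertex \<open>v\<close> and stay in the
  polytope, so that \<open>F\<close> would contain every vertex.
\<close>

lemma proper_face_vanishing_inequality:
  assumes V: "finite V"
    and I: "finite I" "\<And>h. h \<in> I \<Longrightarrow> affine_functional h"
    and P: "convex hull V = {x \<in> affine hull V. \<forall>h\<in>I. 0 \<le> h x}"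
    and F: "F face_of convex hull V" "F \<noteq> {}" "F \<noteq> convex hull V"
  shows "\<exists>h\<in>I. (\<forall>x\<in>F. h x = 0) \<and> (\<exists>v\<in>V. h v \<noteq> 0)"
proof (rule ccontr)
  assume no: "\<not> ?thesis"
  define W where "W = F \<inter> V"
  have W: "finite W" "F = convex hull W"
    using V face_of_convex_hull_finite_eq[OF V F(1)] unfolding W_def by auto
  have ne: "W \<noteq> {}" using F(2) W(2) by auto
  define c where "c = barycenter W"
  have cF: "c \<in> F" using barycenter_in_convex_hull[OF W(1) ne] W(2) by (simp add: c_def)
  \<comment> \<open>Inequalities that are tight on the whole polytope are set aside: they never restrict a step.\<close>
  define J where "J = {h \<in> I. \<exists>v\<in>V. h v \<noteq> 0}"
  have nonneg: "0 \<le> h v" if "h \<in> I" "v \<in> V" for h v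
    using P that hull_inc[of v V convex] by blast
  have pos: "0 < h c" if h: "h \<in> J" for h
  proof -
    have hI: "h \<in> I" using h by (simp add: J_def)
    have "\<exists>w\<in>W. h w \<noteq> 0"
    proof (rule ccontr)
      assume "\<not> (\<exists>w\<in>W. h w \<noteq> 0)"
      then have "h x = 0" if "x \<in> F" for x
        using affine_functional_eq_on_affine_hull[OF I(2)[OF hI] affine_functional_const[of 0], of W x]
          that W(2) convex_hull_subset_affine_hull by blast
      then show False using h no by (auto simp: J_def)
    qed
    then have "0 < (\<Sum>w\<in>W. h w)"
      using nonneg[OF hI] W(1) sum_pos2[of W _ h] unfolding W_def by (metis Int_iff less_eq_real_def)
    then show ?thesis
      using affine_functional_barycenter[OF W(1) ne I(2)[OF hI]] W(1) ne
      by (simp add: c_def card_gt_0_iff)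
  qed
  have "v \<in> F" if v: "v \<in> V" for v
  proof -
    define M where "M = (\<Sum>h\<in>J. h v / h c)"
    \<comment> \<open>Small enough for all inequalities at once: \<open>M\<close> bounds each of the ratios \<open>h v / h c\<close>.\<close>
    define e where "e = 1 / (1 + M)"
    have fJ: "finite J" using I(1) by (simp add: J_def)
    have quot: "0 \<le> h v / h c" if "h \<in> J" for h
      using pos[OF that] nonneg[of h v] that v by (simp add: J_def)
    have M: "0 \<le> M" unfolding M_def by (intro sum_nonneg quot)
    have e: "0 < e" using M by (simp add: e_def)
    have "0 \<le> h (c + e *\<^sub>R (c - v))" if h: "h \<in> I" for h
    proof -
      have eq: "c + e *\<^sub>R (c - v) = (1 + e) *\<^sub>R c + (- e) *\<^sub>R v"
        by (simp add: algebra_simps)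
      have val: "h (c + e *\<^sub>R (c - v)) = (1 + e) * h c - e * h v"
        unfolding eq by (subst affine_functional_combination[OF I(2)[OF h]]) auto
      show ?thesis
      proof (cases "h \<in> J")
        case True
        have "h v / h c \<le> M" unfolding M_def using True fJ quot by (intro member_le_sum) auto
        then have "h v \<le> (1 + M) * h c" using pos[OF True] by (simp add: field_simps)
        then have "e * h v \<le> h c" using M by (simp add: e_def field_simps)
        moreover have "0 < e * h c" using e pos[OF True] by (rule mult_pos_pos)
        moreover have "(1 + e) * h c = h c + e * h c" by (simp add: algebra_simps)
        ultimately show ?thesis using val by linarith
      next
        case False
        then have "\<And>w. w \<in> V \<Longrightarrow> h w = 0" using h by (auto simp: J_def)
        moreover have "h c = 0"
          using affine_functional_barycenter[OF W(1) ne I(2)[OF h]] calculation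
          by (simp add: c_def W_def)
        ultimately show ?thesis using val v by simp
      qed
    qed
    moreover have "c + e *\<^sub>R (c - v) \<in> affine hull V"
    proof -
      have "c \<in> affine hull V"
        using cF face_of_imp_subset[OF F(1)] convex_hull_subset_affine_hull by blast
      then have "(1 + e) *\<^sub>R c + (- e) *\<^sub>R v \<in> affine hull V"
        using hull_inc[OF v] affine_affine_hull[of V] by (intro mem_affine) auto
      then show ?thesis by (simp add: algebra_simps)
    qed
    ultimately have "c + e *\<^sub>R (c - v) \<in> convex hull V" using P by blast
    then show ?thesis using face_of_absorbs[OF F(1) hull_inc[OF v] cF e] by blast
  qed
  then have "convex hull V \<subseteq> F"
    using face_of_imp_convex[OF F(1)] by (intro hull_minimal) auto
  then show False using F(3) face_of_imp_subset[OF F(1)] by blast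
qed

text \<open>
  A point \<open>x\<close> of the zero set outside \<open>F\<close> would enlarge an affine basis of \<open>F\<close>, and the vertex
  \<open>v\<close> with \<open>h v \<noteq> 0\<close> would enlarge it once more: two dimensions more than \<open>F\<close>, but the polytope
  has only one.
\<close>

lemma facet_eq_zero_set:
  assumes V: "finite V" and F: "is_facet_of F (convex hull V)"
    and h: "affine_functional h" "\<And>x. x \<in> F \<Longrightarrow> h x = 0" "v \<in> V" "h v \<noteq> 0"
  shows "F = {x \<in> convex hull V. h x = 0}"
proof -
  have face: "F face_of convex hull V" using F by (simp add: is_facet_of_def)
  have "x \<in> F" if x: "x \<in> convex hull V" "h x = 0" for x
  proof (rule ccontr)
    assume "x \<notin> F"
    then have xF: "x \<notin> affine hull F"
      using face_of_convex_hull_Int_affine_hull[OF V face x(1)] by blast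
    define W where "W = F \<inter> V"
    have W: "finite W" "F = convex hull W"
      using V face_of_convex_hull_finite_eq[OF V face] unfolding W_def by auto
    obtain C where C: "C \<subseteq> W" "finite C" "\<not> affine_dependent C" "affine hull C = affine hull W"
        "affine_dim W = int (card C) - 1"
      using affine_basis_finite[OF W(1)] by blast
    obtain B where B: "B \<subseteq> V" "finite B" "\<not> affine_dependent B" "affine hull B = affine hull V"
        "affine_dim V = int (card B) - 1"
      using affine_basis_finite[OF V] by blast
    have card: "card B = card C + 1"
      using F B(5) C(5) W(2) by (simp add: is_facet_of_def affine_dim_convex_hull)
    have CF: "affine hull C = affine hull F" using C(4) W(2) by (simp add: affine_hull_convex_hull)
    have D: "\<not> affine_dependent (insert x C)"
      using affine_independent_insertI[OF C(3)] xF CF by blast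
    have "h y = 0" if "y \<in> affine hull (insert x C)" for y
    proof (rule affine_functional_eq_on_affine_hull[OF h(1) affine_functional_const _ that])
      show "h z = 0" if "z \<in> insert x C" for z
        using that x(2) h(2) C(1) W_def by auto
    qed
    then have vD: "v \<notin> affine hull (insert x C)" using h(4) by blast
    then have E: "\<not> affine_dependent (insert v (insert x C))"
      by (rule affine_independent_insertI[OF D])
    have "insert v (insert x C) \<subseteq> affine hull B"
      using B(4) x(1) h(3) C(1) W_def convex_hull_subset_affine_hull[of V] hull_subset[of V affine]
      by auto
    then have "card (insert v (insert x C)) \<le> card B"
      using affine_independent_card_le[OF B(2) E] by blast
    moreover have "x \<notin> C" "v \<notin> insert x C"
      using xF CF vD hull_subset[of C affine] hull_subset[of "insert x C" affine] by blast+
    ultimately show False using card C(2) by simp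
  qed
  then show ?thesis using h(2) face_of_imp_subset[OF face] by blast
qed

text \<open>
  Each facet is the zero set of one of the inequalities, so the inequalities cover the facets.
\<close>

lemma card_facets_le_card_inequalities:
  assumes V: "finite V"
    and I: "finite I" "\<And>h. h \<in> I \<Longrightarrow> affine_functional h"
    and P: "convex hull V = {x \<in> affine hull V. \<forall>h\<in>I. 0 \<le> h x}"
  shows "card {F. is_facet_of F (convex hull V)} \<le> card I"
proof -
  have "\<exists>h\<in>I. F = {x \<in> convex hull V. h x = 0}" if F: "is_facet_of F (convex hull V)" for F
  proof -
    have "F face_of convex hull V" "F \<noteq> {}" "F \<noteq> convex hull V"
      using F by (auto simp: is_facet_of_def)
    then obtain h where "h \<in> I" "\<And>x. x \<in> F \<Longrightarrow> h x = 0" "\<exists>v\<in>V. h v \<noteq> 0"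
      using proper_face_vanishing_inequality[OF V I P, of F] by blast
    then show ?thesis using facet_eq_zero_set[OF V F I(2)] by blast
  qed
  then have "{F. is_facet_of F (convex hull V)} \<subseteq> (\<lambda>h. {x \<in> convex hull V. h x = 0}) ` I"
    by auto
  then show ?thesis using I(1) by (meson card_image_le card_mono finite_imageI le_trans)
qed

section \<open>A polytope of dimension d has at least d + 1 facets\<close>

text \<open>
  Gaussian elimination: one pivot \<open>p\<close> removes one equation and one unknown. The equations are
  indexed by arbitrary finite sets because they will be indexed by facets and the unknowns by an
  affine basis.
\<close>

lemma homogeneous_system_nontrivial_solution:
  fixes M :: "'i \<Rightarrow> 'b \<Rightarrow> real"
  assumes "finite I" "finite B" "card I < card B"
  shows "\<exists>c. (\<exists>b\<in>B. c b \<noteq> 0) \<and> (\<forall>i\<in>I. (\<Sum>b\<in>B. c b * M i b) = 0)"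
  using assms
proof (induction I arbitrary: B M rule: finite_induct)
  case empty
  then obtain b where "b \<in> B" by (auto simp: card_gt_0_iff)
  then show ?case by (intro exI[of _ "\<lambda>_. 1"]) auto
next
  case (insert i I)
  show ?case
  proof (cases "\<forall>b\<in>B. M i b = 0")
    case True
    moreover obtain c where "\<exists>b\<in>B. c b \<noteq> 0" "\<forall>i\<in>I. (\<Sum>b\<in>B. c b * M i b) = 0"
      using insert.IH[of B M] insert.prems insert.hyps by auto
    ultimately show ?thesis by (intro exI[of _ c]) auto
  next
    case False
    then obtain p where p: "p \<in> B" "M i p \<noteq> 0" by blast
    \<comment> \<open>Eliminate the unknown at \<open>p\<close> from all other equations.\<close>
    define N where "N j b = M j b - M i b * M j p / M i p" for j b
    have "card I < card (B - {p})"
      using insert.prems insert.hyps p(1) by (simp add: card_Diff_singleton)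
    then obtain c where c: "\<exists>b\<in>B - {p}. c b \<noteq> 0" "\<forall>j\<in>I. (\<Sum>b\<in>B - {p}. c b * N j b) = 0"
      using insert.IH[of "B - {p}" N] insert.prems by auto
    define s where "s = (\<Sum>b\<in>B - {p}. c b * M i b)"
    define d where "d = c(p := - s / M i p)"
    have d: "(\<Sum>b\<in>B. d b * M j b) = (\<Sum>b\<in>B - {p}. c b * M j b) - s / M i p * M j p" for j
    proof -
      have "(\<Sum>b\<in>B - {p}. d b * M j b) = (\<Sum>b\<in>B - {p}. c b * M j b)"
        by (intro sum.cong) (auto simp: d_def)
      then show ?thesis using sum.remove[OF insert.prems(1) p(1), of "\<lambda>b. d b * M j b"]
        by (simp add: d_def)
    qed
    have "(\<Sum>b\<in>B. d b * M j b) = 0" if "j \<in> insert i I" for j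
    proof (cases "j = i")
      case True
      then show ?thesis using d[of i] p(2) by (simp add: s_def)
    next
      case False
      have "0 = (\<Sum>b\<in>B - {p}. c b * N j b)" using c(2) False that by simp
      also have "\<dots> = (\<Sum>b\<in>B - {p}. c b * M j b - (c b * M i b) * (M j p / M i p))"
        by (intro sum.cong) (simp_all add: N_def algebra_simps)
      also have "\<dots> = (\<Sum>b\<in>B - {p}. c b * M j b) - s * (M j p / M i p)"
        by (simp only: sum_subtractf s_def sum_distrib_right)
      finally show ?thesis using d[of j] by simp
    qed
    moreover have "\<exists>b\<in>B. d b \<noteq> 0" using c(1) by (auto simp: d_def)
    ultimately show ?thesis by blast
  qed
qed

lemma zero_set_face_of:
  assumes h: "affine_functional h" "\<And>x. x \<in> P \<Longrightarrow> 0 \<le> h x" and P: "convex P"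
  shows "{x \<in> P. h x = 0} face_of P"
  unfolding face_of_def
proof (intro conjI ballI impI)
  show "convex {x \<in> P. h x = 0}"
    using P h(1) unfolding convex_def by (auto simp: affine_functional_combination)
  fix a b x assume *: "a \<in> P" "b \<in> P" "x \<in> {x \<in> P. h x = 0}" "x \<in> open_segment a b"
  then obtain t where t: "0 < t" "t < 1" "x = (1 - t) *\<^sub>R a + t *\<^sub>R b" by (auto simp: in_segment)
  have "(1 - t) * h a + t * h b = 0"
    using * t(3) affine_functional_combination[OF h(1), of "1 - t" t a b] by simp
  moreover have "0 \<le> (1 - t) * h a" "0 \<le> t * h b" using h(2) * t by auto
  ultimately have "(1 - t) * h a = 0" "t * h b = 0" by linarith+
  then have "h a = 0" "h b = 0" using t by auto
  then show "a \<in> {x \<in> P. h x = 0}" "b \<in> {x \<in> P. h x = 0}" using * by auto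
qed auto

text \<open>
  If the functionals that vanish on the zero set of \<open>f\<close> are only the multiples of \<open>f\<close>, then the
  zero set has codimension one: any vertex that is affinely independent of it and of \<open>v0\<close> would
  give a functional that vanishes on the zero set and at \<open>v0\<close>, but not everywhere.
\<close>

lemma maximal_zero_set_is_facet:
  assumes V: "finite V" and f: "affine_functional f" "\<And>v. v \<in> V \<Longrightarrow> 0 \<le> f v"
    and v0: "v0 \<in> V" "f v0 \<noteq> 0" and z: "z \<in> V" "f z = 0"
    and proportional: "\<And>g. affine_functional g \<Longrightarrow> (\<And>v. v \<in> V \<Longrightarrow> f v = 0 \<Longrightarrow> g v = 0)
                 \<Longrightarrow> \<exists>a. \<forall>v\<in>V. g v = a * f v"
  shows "is_facet_of {x \<in> convex hull V. f x = 0} (convex hull V)"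
proof -
  define F where "F = {x \<in> convex hull V. f x = 0}"
  have face: "F face_of convex hull V"
    unfolding F_def using f V affine_functional_nonneg_on_convex_hull
    by (intro zero_set_face_of convex_convex_hull) blast+
  define W where "W = F \<inter> V"
  have W: "finite W" "F = convex hull W"
    using V face_of_convex_hull_finite_eq[OF V face] unfolding W_def by auto
  obtain C where C: "C \<subseteq> W" "finite C" "\<not> affine_dependent C" "affine hull C = affine hull W"
      "affine_dim W = int (card C) - 1"
    using affine_basis_finite[OF W(1)] by blast
  have "f x = 0" if "x \<in> affine hull C" for x
    by (rule affine_functional_eq_on_affine_hull[OF f(1) affine_functional_const _ that])
      (use C(1) in \<open>auto simp: W_def F_def\<close>)
  then have v0C: "v0 \<notin> affine hull C" using v0(2) by blast
  then have D: "\<not> affine_dependent (insert v0 C)" by (rule affine_independent_insertI[OF C(3)])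
  have "V \<subseteq> affine hull (insert v0 C)"
  proof (rule ccontr)
    assume "\<not> V \<subseteq> affine hull (insert v0 C)"
    then obtain w where w: "w \<in> V" "w \<notin> affine hull (insert v0 C)" by blast
    then have E: "\<not> affine_dependent (insert w (insert v0 C))"
      by (intro affine_independent_insertI[OF D])
    obtain g where g: "affine_functional g"
        "\<And>b. b \<in> insert w (insert v0 C) \<Longrightarrow> g b = of_bool (b = w)"
      using affine_functional_extend[OF E, of "\<lambda>b. of_bool (b = w)"] by blast
    have wne: "w \<noteq> v0" "w \<notin> C" using w(2) hull_subset[of "insert v0 C" affine] by blast+
    have "g v = 0" if "v \<in> V" "f v = 0" for v
    proof (rule affine_functional_eq_on_affine_hull[OF g(1) affine_functional_const])
      show "v \<in> affine hull C"
        using that C(4) hull_inc[of v V convex] hull_inc[of v W affine] by (simp add: W_def F_def)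
      show "g x = 0" if "x \<in> C" for x using that g(2)[of x] wne by auto
    qed
    then obtain a where a: "\<And>v. v \<in> V \<Longrightarrow> g v = a * f v" using proportional[OF g(1)] by blast
    have "a * f v0 = 0" using a[OF v0(1)] g(2)[of v0] wne by simp
    then have "g w = 0" using a[OF w(1)] v0(2) by simp
    then show False using g(2)[of w] by simp
  qed
  then have "affine hull V \<subseteq> affine hull (insert v0 C)"
    by (intro hull_minimal) auto
  moreover have "affine hull (insert v0 C) \<subseteq> affine hull V"
    using C(1) v0(1) by (intro hull_mono) (auto simp: W_def)
  ultimately have "affine_dim V = int (card (insert v0 C)) - 1"
    using affine_dim_eq_card[OF _ D, of V] C(2) by auto
  moreover have "v0 \<notin> C" using v0C hull_subset[of C affine] by blast
  ultimately have "affine_dim F = affine_dim (convex hull V) - 1"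
    using C(2,5) W(2) by (simp add: affine_dim_convex_hull)
  moreover have "z \<in> F" using z hull_inc[of z V convex] by (simp add: F_def)
  ultimately show ?thesis using face unfolding is_facet_of_def F_def by blast
qed

text \<open>
  The functionals that are nonnegative on \<open>V\<close> form a cone whose extreme rays are the facet
  functionals, so a linear form (here \<open>\<lambda>f. \<Sum>b\<in>B. c b * f b\<close>) that vanishes on these vanishes on
  the cone. The induction decreases the number of points of \<open>V\<close> at which \<open>f\<close> is positive.
  If the zero set of \<open>f\<close> does not already determine \<open>f\<close> up to scaling, some \<open>g\<close> vanishes on it
  without being a multiple of \<open>f\<close>. With \<open>p\<close> and \<open>q\<close> the largest and smallest value of \<open>g / f\<close>,
  the functionals \<open>p f - g\<close> and \<open>g - q f\<close> are nonnegative, have larger zero sets and add up to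
  \<open>(p - q) f\<close>. Otherwise the zero set is a facet. It is nonempty because \<open>B\<close> has two elements:
  in dimension 0 the only proper face is empty, and the empty face does not count as a facet.
\<close>

lemma nonneg_functional_annihilated:
  assumes V: "finite V" and B: "B \<subseteq> V" and two: "b1 \<in> B" "b2 \<in> B" "b1 \<noteq> b2"
      "\<not> affine_dependent B"
    and c: "\<And>f. affine_functional f \<Longrightarrow>
        is_facet_of {x \<in> convex hull V. f x = 0} (convex hull V) \<Longrightarrow> (\<Sum>b\<in>B. c b * f b) = 0"
    and f: "affine_functional f" "\<And>v. v \<in> V \<Longrightarrow> 0 \<le> f v"
  shows "(\<Sum>b\<in>B. c b * f b) = 0"
  using f
proof (induction "card {v \<in> V. f v \<noteq> 0}" arbitrary: f rule: less_induct)
  case less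
  note f = less.prems
  define N where "N = {v \<in> V. f v \<noteq> 0}"
  have N: "finite N" "\<And>v. v \<in> N \<Longrightarrow> 0 < f v" using V f(2) by (auto simp: N_def less_le)
  show ?case
  proof (cases "N = {}")
    case True
    then have "\<And>b. b \<in> B \<Longrightarrow> f b = 0" using B by (auto simp: N_def)
    then show ?thesis by simp
  next
    case False
    show ?thesis
    proof (cases "\<exists>g. affine_functional g \<and> (\<forall>v\<in>V. f v = 0 \<longrightarrow> g v = 0) \<and>
        \<not> (\<exists>a. \<forall>v\<in>V. g v = a * f v)")
      case True
      then obtain g where g: "affine_functional g" "\<And>v. v \<in> V \<Longrightarrow> f v = 0 \<Longrightarrow> g v = 0"
          "\<And>a. \<exists>v\<in>V. g v \<noteq> a * f v"
        by blast
      define R where "R = (\<lambda>v. g v / f v) ` N"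
      have R: "finite R" "R \<noteq> {}" using N False by (auto simp: R_def)
      define p q where "p = Max R" and "q = Min R"
      have bound: "q * f v \<le> g v \<and> g v \<le> p * f v" if "v \<in> V" for v
      proof (cases "v \<in> N")
        case True
        then have "g v / f v \<le> p" "q \<le> g v / f v"
          using R unfolding p_def q_def by (auto simp: R_def)
        then show ?thesis using N(2)[OF True] by (simp add: field_simps)
      qed (use g(2) that in \<open>auto simp: N_def\<close>)
      have step: "(\<Sum>b\<in>B. c b * k b) = 0"
        if k: "affine_functional k" "\<And>v. v \<in> V \<Longrightarrow> 0 \<le> k v" "\<And>v. v \<in> V \<Longrightarrow> f v = 0 \<Longrightarrow> k v = 0"
          "w \<in> N" "k w = 0" for k w
      proof (rule less.hyps[OF _ k(1,2)])
        have "{v \<in> V. k v \<noteq> 0} \<subset> {v \<in> V. f v \<noteq> 0}" using k(3-5) by (auto simp: N_def)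
        then show "card {v \<in> V. k v \<noteq> 0} < card {v \<in> V. f v \<noteq> 0}"
          using V by (intro psubset_card_mono) auto
      qed
      obtain w where w: "w \<in> N" "p = g w / f w" using Max_in[OF R] by (auto simp: R_def p_def)
      obtain w' where w': "w' \<in> N" "q = g w' / f w'" using Min_in[OF R] by (auto simp: R_def q_def)
      have "(\<Sum>b\<in>B. c b * (p * f b - g b)) = 0"
        using w N(2)[OF w(1)] bound g(2)
        by (intro step[of _ w] affine_functional_diff affine_functional_cmult f(1) g(1)) auto
      moreover have "(\<Sum>b\<in>B. c b * (g b - q * f b)) = 0"
        using w' N(2)[OF w'(1)] bound g(2)
        by (intro step[of _ w'] affine_functional_diff affine_functional_cmult f(1) g(1)) auto
      ultimately have "0 = (\<Sum>b\<in>B. c b * (p * f b - g b)) + (\<Sum>b\<in>B. c b * (g b - q * f b))"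
        by simp
      also have "\<dots> = (\<Sum>b\<in>B. (p - q) * (c b * f b))"
        unfolding sum.distrib[symmetric] by (intro sum.cong) (simp_all add: algebra_simps)
      also have "\<dots> = (p - q) * (\<Sum>b\<in>B. c b * f b)" by (simp add: sum_distrib_left)
      finally have "p = q \<or> (\<Sum>b\<in>B. c b * f b) = 0" by simp
      moreover have "p \<noteq> q"
      proof
        assume "p = q"
        then have "\<forall>v\<in>V. g v = p * f v" using bound by (auto intro: antisym)
        then show False using g(3) by blast
      qed
      ultimately show ?thesis by blast
    next
      case proportional: False
      obtain v0 where v0: "v0 \<in> V" "f v0 \<noteq> 0" using \<open>N \<noteq> {}\<close> by (auto simp: N_def)
      have "\<exists>z\<in>V. f z = 0"
      proof (rule ccontr)
        assume pos: "\<not> (\<exists>z\<in>V. f z = 0)"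
        obtain g where g: "affine_functional g" "\<And>b. b \<in> B \<Longrightarrow> g b = of_bool (b = b1)"
          using affine_functional_extend[OF two(4), of "\<lambda>b. of_bool (b = b1)"] by blast
        then obtain a where a: "\<forall>v\<in>V. g v = a * f v" using proportional pos by blast
        then have "a * f b2 = 0" using g(2)[OF two(2)] two B by auto
        then have "a = 0" using pos two(2) B by auto
        then have "g b1 = 0" using a two(1) B by auto
        then show False using g(2)[OF two(1)] by simp
      qed
      then obtain z where z: "z \<in> V" "f z = 0" by blast
      have "is_facet_of {x \<in> convex hull V. f x = 0} (convex hull V)"
        using proportional by (intro maximal_zero_set_is_facet[OF V f v0 z]) blast+
      then show ?thesis by (rule c[OF f(1)])
    qed
  qed
qed

text \<open>
  Some multiple of \<open>g\<close> agrees with \<open>f\<close> at a vertex off the facet. The difference vanishes there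
  and on the facet, hence everywhere.
\<close>

lemma facet_functional_unique_up_to_scaling:
  assumes V: "finite V" and facet: "is_facet_of {x \<in> convex hull V. f x = 0} (convex hull V)"
    and f: "affine_functional f" and g: "affine_functional g"
      "{x \<in> convex hull V. g x = 0} = {x \<in> convex hull V. f x = 0}"
  shows "\<exists>a. \<forall>v\<in>V. f v = a * g v"
proof -
  define F where "F = {x \<in> convex hull V. f x = 0}"
  have "F \<noteq> convex hull V"
    using facet unfolding F_def[symmetric] is_facet_of_def by force
  have "\<exists>v\<in>V. g v \<noteq> 0"
  proof (rule ccontr)
    assume "\<not> (\<exists>v\<in>V. g v \<noteq> 0)"
    then have "g x = 0" if "x \<in> convex hull V" for x
      using affine_functional_eq_on_affine_hull[OF g(1) affine_functional_const[of 0], of V x] that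
        convex_hull_subset_affine_hull by blast
    then show False using \<open>F \<noteq> convex hull V\<close> g(2) by (auto simp: F_def)
  qed
  then obtain v where v: "v \<in> V" "g v \<noteq> 0" by blast
  define h where "h x = f x - (f v / g v) * g x" for x
  have h: "affine_functional h"
    unfolding h_def by (intro affine_functional_diff affine_functional_cmult f g(1))
  have hF: "h x = 0" if "x \<in> F" for x using that g(2) by (auto simp: F_def h_def)
  have "h w = 0" if "w \<in> V" for w
  proof (rule ccontr)
    assume w: "h w \<noteq> 0"
    have "F = {x \<in> convex hull V. h x = 0}"
      by (rule facet_eq_zero_set[OF V facet[folded F_def] h hF that w])
    moreover have "h v = 0" using v by (simp add: h_def)
    ultimately have "v \<in> F" using v hull_inc[of v V convex] by blast
    then show False using v g(2) by (auto simp: F_def)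
  qed
  then have "f w = (f v / g v) * g w" if "w \<in> V" for w using that by (simp add: h_def)
  then show ?thesis by blast
qed

text \<open>
  The affine functionals on a \<open>d\<close>-dimensional polytope form a space of dimension \<open>d + 1\<close>, which
  the facet functionals span. Concretely: with at most \<open>d\<close> facets some nonzero linear form in the
  values on an affine basis annihilates one functional \<open>\<phi> F\<close> per facet \<open>F\<close>, hence all
  nonnegative functionals, hence all functionals, as each becomes nonnegative after adding a
  constant. This contradicts the existence of a dual basis.
\<close>

theorem card_facets_ge_dim_plus_one:
  assumes V: "finite V" and d: "affine_dim (convex hull V) = int d" "0 < d"
  shows "d + 1 \<le> card {F. is_facet_of F (convex hull V)}"
proof (rule ccontr)
  define P where "P = convex hull V"
  define Fs where "Fs = {F. is_facet_of F P}"
  assume "\<not> d + 1 \<le> card {F. is_facet_of F (convex hull V)}"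
  then have few: "card Fs < d + 1" by (simp add: Fs_def P_def)
  have finF: "finite Fs"
    unfolding Fs_def P_def
    by (rule finite_subset[OF _ finite_faces_convex_hull[OF V]]) (auto simp: is_facet_of_def)
  obtain B where B: "B \<subseteq> V" "finite B" "\<not> affine_dependent B" "affine hull B = affine hull V"
      "affine_dim V = int (card B) - 1"
    using affine_basis_finite[OF V] by blast
  have cardB: "card B = d + 1" using B(5) d by (simp add: affine_dim_convex_hull)
  define \<phi> where "\<phi> F = (SOME g. affine_functional g \<and> {x \<in> P. g x = 0} = F)" for F
  obtain c where c: "\<exists>b\<in>B. c b \<noteq> 0" "\<And>F. F \<in> Fs \<Longrightarrow> (\<Sum>b\<in>B. c b * \<phi> F b) = 0"
    using homogeneous_system_nontrivial_solution[OF finF B(2), of \<phi>] few cardB by auto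
  have ann: "(\<Sum>b\<in>B. c b * f b) = 0"
    if f: "affine_functional f" "is_facet_of {x \<in> P. f x = 0} P" for f
  proof -
    define F where "F = {x \<in> P. f x = 0}"
    have "affine_functional (\<phi> F) \<and> {x \<in> P. \<phi> F x = 0} = F"
      unfolding \<phi>_def by (rule someI[of _ f]) (simp add: f F_def)
    then obtain a where "\<forall>v\<in>V. f v = a * \<phi> F v"
      using facet_functional_unique_up_to_scaling[OF V, of f "\<phi> F"] f by (auto simp: F_def P_def)
    then have "(\<Sum>b\<in>B. c b * f b) = (\<Sum>b\<in>B. a * (c b * \<phi> F b))"
      using B(1) by (intro sum.cong) auto
    also have "\<dots> = a * (\<Sum>b\<in>B. c b * \<phi> F b)" by (simp add: sum_distrib_left)
    also have "\<dots> = 0" using c(2)[of F] f(2) by (simp add: Fs_def F_def)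
    finally show ?thesis .
  qed
  have "\<not> card B \<le> Suc 0" using cardB d(2) by simp
  then obtain b1 b2 where two: "b1 \<in> B" "b2 \<in> B" "b1 \<noteq> b2"
    using card_le_Suc0_iff_eq[OF B(2)] by blast
  have nonneg: "(\<Sum>b\<in>B. c b * f b) = 0"
    if "affine_functional f" "\<And>v. v \<in> V \<Longrightarrow> 0 \<le> f v" for f
    using nonneg_functional_annihilated[OF V B(1) two B(3) _ that, of c] ann by (simp add: P_def)
  obtain b0 where b0: "b0 \<in> B" "c b0 \<noteq> 0" using c(1) by blast
  obtain g where g: "affine_functional g" "\<And>b. b \<in> B \<Longrightarrow> g b = of_bool (b = b0)"
    using affine_functional_extend[OF B(3), of "\<lambda>b. of_bool (b = b0)"] by blast
  define M where "M = (\<Sum>v\<in>V. \<bar>g v\<bar>)"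
  have M: "\<bar>g v\<bar> \<le> M" if "v \<in> V" for v unfolding M_def using V that by (intro member_le_sum) auto
  have "(\<Sum>b\<in>B. c b * (g b + M)) = 0"
  proof (rule nonneg)
    show "0 \<le> g v + M" if "v \<in> V" for v using M[OF that] by linarith
  qed (intro affine_functional_add affine_functional_const g(1))
  moreover have "(\<Sum>b\<in>B. c b * M) = 0"
    by (rule nonneg) (auto simp: M_def intro: affine_functional_const sum_nonneg)
  ultimately have "(\<Sum>b\<in>B. c b * g b) = 0" by (simp add: algebra_simps sum.distrib)
  moreover have "(\<Sum>b\<in>B. c b * g b) = (\<Sum>b\<in>B. if b = b0 then c b else 0)"
    using g(2) by (intro sum.cong) auto
  ultimately show False using b0 B(2) by (simp add: sum.delta)
qed

section \<open>Lexicographic initial segments of the cube\<close>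

abbreviation coord :: "nat \<Rightarrow> (nat \<Rightarrow>\<^sub>0 real) \<Rightarrow> real" where
  "coord i x \<equiv> Poly_Mapping.lookup x i"

abbreviation unit_vec :: "nat \<Rightarrow> (nat \<Rightarrow>\<^sub>0 real)" where
  "unit_vec i \<equiv> Poly_Mapping.single i 1"

lemma coord_scaleR [simp]: "coord i (r *\<^sub>R x) = r * coord i x"
proof -
  have "finite {j. r *\<^sub>R coord j x \<noteq> 0}"
    by (rule finite_subset[OF _ finite_lookup[of x]]) auto
  then show ?thesis by (simp add: scaleR_poly_mapping_def Abs_poly_mapping_inverse)
qed

lemma coord_unit_vec [simp]: "coord i (unit_vec j) = of_bool (i = j)"
  by (auto simp: lookup_single when_def)

lemma linear_coord: "linear (coord i)"
  by (auto simp: linear_iff lookup_add)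

lemma affine_functional_coord: "affine_functional (coord i)"
  unfolding affine_functional_def
  by (rule exI[of _ "coord i"], rule exI[of _ 0]) (simp add: linear_coord)

lemma zero_one_points_0: "zero_one_points 0 = {0}"
  by (auto simp: zero_one_points_def intro!: poly_mapping_eqI)

lemma zero_one_points_Suc:
  "zero_one_points (Suc k) = zero_one_points k \<union> (+) (unit_vec k) ` zero_one_points k"
proof (intro equalityI subsetI)
  fix v assume v: "v \<in> zero_one_points (Suc k)"
  show "v \<in> zero_one_points k \<union> (+) (unit_vec k) ` zero_one_points k"
  proof (cases "coord k v = 0")
    case True
    then have "\<forall>i\<ge>k. coord i v = 0"
      using v unfolding zero_one_points_def by (metis (mono_tags, lifting) Suc_leI le_neq_implies_less mem_Collect_eq)
    then show ?thesis using v by (auto simp: zero_one_points_def)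
  next
    case False
    then have k: "coord k v = 1" using v by (auto simp: zero_one_points_def)
    have "coord i v = of_bool (i = k)" if "k \<le> i" for i
      using v k that unfolding zero_one_points_def by (cases "i = k") auto
    then have "v - unit_vec k \<in> zero_one_points k"
      using v by (auto simp: zero_one_points_def lookup_minus)
    moreover have "v = unit_vec k + (v - unit_vec k)" by simp
    ultimately show ?thesis by blast
  qed
qed (auto simp: zero_one_points_def lookup_add less_Suc_eq)

lemma zero_one_points_disjoint:
  "zero_one_points k \<inter> (+) (unit_vec k) ` zero_one_points k = {}"
  by (auto simp: zero_one_points_def lookup_add)

lemma finite_zero_one_points: "finite (zero_one_points k)"
  by (induction k) (simp_all add: zero_one_points_0 zero_one_points_Suc)

lemma card_zero_one_points: "card (zero_one_points k) = 2 ^ k"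
proof (induction k)
  case (Suc k)
  then show ?case
    using card_Un_disjoint[OF _ _ zero_one_points_disjoint[of k]] finite_zero_one_points[of k]
    by (simp add: zero_one_points_Suc card_image)
qed (simp add: zero_one_points_0)

text \<open>
  For \<open>1 \<le> n \<le> 2 ^ k\<close> these are the first \<open>n\<close> points of the \<open>k\<close>-cube in the order in which the
  coordinate vectors are read as binary numbers \<open>0, 1, 2, \<dots>\<close> with coordinate \<open>k - 1\<close> as the most
  significant bit.
\<close>

fun lex_points :: "nat \<Rightarrow> nat \<Rightarrow> (nat \<Rightarrow>\<^sub>0 real) set" where
  "lex_points 0 n = {0}"
| "lex_points (Suc k) n =
    (if n \<le> 2 ^ k then lex_points k n
     else zero_one_points k \<union> (+) (unit_vec k) ` lex_points k (n - 2 ^ k))"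

lemma lex_points_subset: "lex_points k n \<subseteq> zero_one_points k"
proof (induction k arbitrary: n)
  case (Suc k)
  then show ?case using zero_one_points_Suc[of k] by (auto split: if_splits)
qed (simp add: zero_one_points_0)

lemma finite_lex_points: "finite (lex_points k n)"
  by (rule finite_subset[OF lex_points_subset finite_zero_one_points])

lemma card_lex_points:
  assumes "1 \<le> n" "n \<le> 2 ^ k"
  shows "card (lex_points k n) = n"
  using assms
proof (induction k arbitrary: n)
  case (Suc k)
  show ?case
  proof (cases "n \<le> 2 ^ k")
    case False
    let ?L = "lex_points k (n - 2 ^ k)"
    have "card ((+) (unit_vec k) ` ?L) = n - 2 ^ k"
      using Suc.IH[of "n - 2 ^ k"] Suc.prems False by (simp add: card_image)
    moreover have "zero_one_points k \<inter> (+) (unit_vec k) ` ?L = {}"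
      using zero_one_points_disjoint[of k] lex_points_subset[of k "n - 2 ^ k"] by blast
    ultimately show ?thesis
      using False card_Un_disjoint[of "zero_one_points k" "(+) (unit_vec k) ` ?L"]
      by (simp add: finite_zero_one_points finite_lex_points card_zero_one_points)
  qed (use Suc in simp)
qed simp

lemma zero_mem_lex_points: "0 \<in> lex_points k n"
  by (induction k arbitrary: n) (auto simp: zero_one_points_def)

lemma unit_vec_mem_lex_points:
  assumes "2 ^ k < n" "i \<le> k"
  shows "unit_vec i \<in> lex_points (Suc k) n"
proof (cases "i = k")
  case True
  then show ?thesis using assms(1) zero_mem_lex_points[of k "n - 2 ^ k"] by force
next
  case False
  then have "unit_vec i \<in> zero_one_points k" using assms(2) by (auto simp: zero_one_points_def)
  then show ?thesis using assms(1) by simp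
qed

text \<open>
  The cover inequalities of the initial segment, homogenized by \<open>s\<close>. A 0/1 point \<open>y\<close> comes after
  \<open>n - 1\<close> iff it has a 1 at some position \<open>k\<close> where \<open>n - 1\<close> has bit 0 and also at all more
  significant positions where \<open>n - 1\<close> has bit 1. Each position with bit 0 thus gives an inequality
  \<open>y k \<le> (\<Sum>j. s - y j)\<close>, where \<open>j\<close> ranges over the more significant positions with bit 1, and
  there are at most \<open>k\<close> of them. The argument \<open>r\<close> accumulates the right-hand side; the bit at
  position \<open>k\<close> is 1 iff \<open>2 ^ k < n\<close>.
\<close>

fun covers :: "nat \<Rightarrow> nat \<Rightarrow> real \<Rightarrow> real \<Rightarrow> (nat \<Rightarrow> real) \<Rightarrow> bool" where
  "covers 0 n s r y = True"
| "covers (Suc k) n s r y =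
    (if n \<le> 2 ^ k then y k \<le> r \<and> covers k n s r y
     else covers k (n - 2 ^ k) s (r + (s - y k)) y)"

lemma covers_cong:
  assumes "\<And>i. i < k \<Longrightarrow> y i = z i"
  shows "covers k n s r y = covers k n s r z"
  using assms by (induction k arbitrary: n r) simp_all

text \<open>
  Slack \<open>s\<close> is what a 0 at a position with bit 1 contributes. A point with such a 0 precedes
  the last point of the segment whatever its less significant coordinates are.
\<close>

lemma covers_if_slack:
  assumes "s \<le> r" "\<And>i. i < k \<Longrightarrow> y i \<le> s"
  shows "covers k n s r y"
  using assms
proof (induction k arbitrary: n r)
  case (Suc k)
  have "y k \<le> s" "\<And>i. i < k \<Longrightarrow> y i \<le> s" using Suc.prems(2) by auto
  then show ?case using Suc.IH[of r n] Suc.IH[of "r + (s - y k)" "n - 2 ^ k"] Suc.prems(1) by auto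
qed simp

lemma covers_lex_points:
  assumes "v \<in> lex_points k n" "0 \<le> r"
  shows "covers k n 1 r (\<lambda>i. coord i v)"
  using assms
proof (induction k arbitrary: n r v)
  case (Suc k)
  show ?case
  proof (cases "n \<le> 2 ^ k")
    case True
    then have "v \<in> lex_points k n" using Suc.prems by simp
    moreover have "coord k v = 0"
      using calculation lex_points_subset[of k n] by (auto simp: zero_one_points_def)
    ultimately show ?thesis using True Suc by simp
  next
    case False
    then consider "v \<in> zero_one_points k" |
      w where "w \<in> lex_points k (n - 2 ^ k)" "v = unit_vec k + w"
      using Suc.prems by auto
    then show ?thesis
    proof cases
      case 1
      then have "covers k (n - 2 ^ k) 1 (r + 1) (\<lambda>i. coord i v)"
        using Suc.prems(2) by (intro covers_if_slack) (auto simp: zero_one_points_def)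
      moreover have "coord k v = 0" using 1 by (auto simp: zero_one_points_def)
      ultimately show ?thesis using False by simp
    next
      case 2
      have "coord k w = 0"
        using 2(1) lex_points_subset[of k "n - 2 ^ k"] by (auto simp: zero_one_points_def)
      then have "coord k v = 1" by (simp add: 2(2) lookup_add)
      moreover have "covers k (n - 2 ^ k) 1 r (\<lambda>i. coord i v)"
        using Suc.IH[OF 2(1) Suc.prems(2)]
        by (subst covers_cong[of k _ "\<lambda>i. coord i w"]) (auto simp: 2(2) lookup_add)
      ultimately show ?thesis using False by simp
    qed
  qed
qed simp

text \<open>
  Weighted sums of points of a convex set merge into one weighted point; the case of total
  weight 0 needs no division.
\<close>

lemma convex_cone_sum:
  assumes "convex C" "a \<in> C" "b \<in> C" "0 \<le> \<alpha>" "0 \<le> \<beta>"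
  shows "\<exists>c\<in>C. \<alpha> *\<^sub>R a + \<beta> *\<^sub>R b = (\<alpha> + \<beta>) *\<^sub>R c"
proof (cases "\<alpha> + \<beta> = 0")
  case True
  then have "\<alpha> = 0" "\<beta> = 0" using assms by linarith+
  then show ?thesis using assms by auto
next
  case False
  let ?c = "(\<alpha> / (\<alpha> + \<beta>)) *\<^sub>R a + (\<beta> / (\<alpha> + \<beta>)) *\<^sub>R b"
  have "?c \<in> C"
    using assms False by (intro convexD[OF assms(1)]) (auto simp: add_divide_distrib[symmetric])
  moreover have "(\<alpha> + \<beta>) *\<^sub>R ?c = \<alpha> *\<^sub>R a + \<beta> *\<^sub>R b"
    using False by (simp add: scaleR_add_right)
  ultimately show ?thesis by metis
qed

text \<open>
  This is the integrality of the cube inequalities together with the cover inequalities, in a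
  form that permits induction. The parameter \<open>s\<close> makes it homogeneous: all points of total weight
  \<open>s\<close> are considered. Of this weight a part \<open>r\<close> is already free, meaning that it may use
  arbitrary cube points because a more significant coordinate made them small; only the rest has to
  consist of points of the initial segment. For \<open>r = 0\<close> and \<open>s = 1\<close> the lemma says that the
  inequalities describe the convex hull of \<^term>\<open>lex_points k n\<close>.

  In the induction step, the top coordinate \<open>t\<close> is the weight of the points with top bit 1. If the
  initial segment lies in the facet with top bit 0, all of \<open>t\<close> must be taken from the free part,
  which is possible because \<open>t \<le> r\<close>. Otherwise the weight \<open>u = s - t\<close> of the points with top
  bit 0 becomes free for the remaining coordinates. When the free weight would exceed \<open>s\<close>, all
  remaining coordinates come from one cube point and only the top bits must be distributed.
\<close>

lemma lex_points_decomposition: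
  assumes "0 \<le> s" "0 \<le> r" "1 \<le> n" "n \<le> 2 ^ k"
    and "\<And>i. i < k \<Longrightarrow> 0 \<le> coord i x \<and> coord i x \<le> s"
    and "\<And>i. k \<le> i \<Longrightarrow> coord i x = 0"
    and "covers k n s r (\<lambda>i. coord i x)"
  shows "\<exists>c \<in> convex hull zero_one_points k. \<exists>p \<in> convex hull lex_points k n.
    x = min r s *\<^sub>R c + (s - min r s) *\<^sub>R p"
  using assms
proof (induction k arbitrary: n r x)
  case 0
  then have "x = 0" by (intro poly_mapping_eqI) simp
  then show ?case by (simp add: zero_one_points_0)
next
  case (Suc k)
  define e where "e = unit_vec k"
  define t where "t = coord k x"
  define x' where "x' = x - t *\<^sub>R e"
  have x: "x = x' + t *\<^sub>R e" by (simp add: x'_def)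
  have t: "0 \<le> t" "t \<le> s" using Suc.prems(5)[of k] by (auto simp: t_def)
  have x'1: "0 \<le> coord i x' \<and> coord i x' \<le> s" if "i < k" for i
    using Suc.prems(5)[of i] that by (simp add: x'_def lookup_minus e_def)
  have x'2: "coord i x' = 0" if "k \<le> i" for i
    using Suc.prems(6)[of i] that by (cases "i = k") (auto simp: x'_def lookup_minus e_def t_def)
  have cov': "covers k m s q (\<lambda>i. coord i x') = covers k m s q (\<lambda>i. coord i x)" for m q
    by (rule covers_cong) (simp add: x'_def lookup_minus e_def)
  let ?Q = "convex hull zero_one_points k" and ?Q' = "convex hull zero_one_points (Suc k)"
  let ?L' = "convex hull lex_points (Suc k) n"
  have hull_shift: "convex hull ((+) e ` A) = (+) e ` (convex hull A)" for A
    by (rule convex_hull_translation)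
  have Q': "?Q \<subseteq> ?Q'" "(+) e ` ?Q \<subseteq> ?Q'"
    using hull_mono[of "zero_one_points k" "zero_one_points (Suc k)" convex]
      hull_mono[of "(+) e ` zero_one_points k" "zero_one_points (Suc k)" convex]
    by (auto simp: zero_one_points_Suc e_def hull_shift[unfolded e_def])
  have coneQ: "\<exists>c\<in>?Q'. \<alpha> *\<^sub>R a + \<beta> *\<^sub>R b = (\<alpha> + \<beta>) *\<^sub>R c"
    if "a \<in> ?Q'" "b \<in> ?Q'" "0 \<le> \<alpha>" "0 \<le> \<beta>" for a b \<alpha> \<beta>
    using convex_cone_sum[OF convex_convex_hull that] .
  have coneL: "\<exists>c\<in>?L'. \<alpha> *\<^sub>R a + \<beta> *\<^sub>R b = (\<alpha> + \<beta>) *\<^sub>R c"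
    if "a \<in> ?L'" "b \<in> ?L'" "0 \<le> \<alpha>" "0 \<le> \<beta>" for a b \<alpha> \<beta>
    using convex_cone_sum[OF convex_convex_hull that] .
  show ?case
  proof (cases "n \<le> 2 ^ k")
    case True
    have tr: "t \<le> r" and cov: "covers k n s r (\<lambda>i. coord i x')"
      using Suc.prems(7) True by (simp_all add: cov' t_def)
    obtain c p where cp: "c \<in> ?Q" "p \<in> convex hull lex_points k n"
        "x' = min r s *\<^sub>R c + (s - min r s) *\<^sub>R p"
      using Suc.IH[OF Suc.prems(1,2,3) True x'1 x'2 cov] by blast
    have "c \<in> ?Q'" "e + c \<in> ?Q'" using cp(1) Q' by auto
    then obtain c' where c': "c' \<in> ?Q'"
        "t *\<^sub>R (e + c) + (min r s - t) *\<^sub>R c = (t + (min r s - t)) *\<^sub>R c'"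
      using coneQ[of "e + c" c t "min r s - t"] t tr by auto
    have "x = min r s *\<^sub>R c' + (s - min r s) *\<^sub>R p"
    proof -
      have "x = (t *\<^sub>R (e + c) + (min r s - t) *\<^sub>R c) + (s - min r s) *\<^sub>R p"
        unfolding x cp(3) by (simp add: algebra_simps)
      then show ?thesis unfolding c'(2) by simp
    qed
    then show ?thesis using c'(1) cp(2) True by auto
  next
    case False
    define u where "u = s - t"
    have u: "0 \<le> u" using t by (simp add: u_def)
    have cov: "covers k (n - 2 ^ k) s (r + u) (\<lambda>i. coord i x')"
      using Suc.prems(7) False by (simp add: cov' t_def u_def)
    have n': "1 \<le> n - 2 ^ k" "n - 2 ^ k \<le> 2 ^ k" "0 \<le> r + u"
      using False Suc.prems u by auto
    obtain c p where cp: "c \<in> ?Q" "p \<in> convex hull lex_points k (n - 2 ^ k)"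
        "x' = min (r + u) s *\<^sub>R c + (s - min (r + u) s) *\<^sub>R p"
      using Suc.IH[OF Suc.prems(1) n'(3,1,2) x'1 x'2 cov] by blast
    have L': "?Q \<subseteq> ?L'" "(+) e ` (convex hull lex_points k (n - 2 ^ k)) \<subseteq> ?L'"
      using False hull_mono[of "zero_one_points k" "lex_points (Suc k) n" convex]
        hull_mono[of "(+) e ` lex_points k (n - 2 ^ k)" "lex_points (Suc k) n" convex]
      by (auto simp: e_def hull_shift[unfolded e_def])
    have mem: "c \<in> ?Q'" "e + c \<in> ?Q'" "c \<in> ?L'" "e + p \<in> ?L'" using cp Q' L' by auto
    consider "r + u \<le> s" | "s < r + u" "r \<le> s" | "s < r" by linarith
    then show ?thesis
    proof cases
      case 1
      \<comment> \<open>The points with top bit 0 that are not free yet lie in the initial segment.\<close>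
      obtain q where q: "q \<in> ?L'" "u *\<^sub>R c + (s - r - u) *\<^sub>R (e + p) = (u + (s - r - u)) *\<^sub>R q"
        using coneL[OF mem(3,4), of u "s - r - u"] u 1 by auto
      have "x = r *\<^sub>R (e + c) + (u *\<^sub>R c + (s - r - u) *\<^sub>R (e + p))"
        unfolding x cp(3) using 1 by (simp add: min_absorb1 algebra_simps u_def)
      then have "x = min r s *\<^sub>R (e + c) + (s - min r s) *\<^sub>R q"
        unfolding q(2) using 1 u by (simp add: min_absorb1)
      then show ?thesis using mem(2) q(1) by blast
    next
      case 2
      obtain q where q: "q \<in> ?Q'" "t *\<^sub>R (e + c) + (r - t) *\<^sub>R c = (t + (r - t)) *\<^sub>R q"
        using coneQ[OF mem(2,1), of t "r - t"] t 2 by (auto simp: u_def)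
      have "x = (t *\<^sub>R (e + c) + (r - t) *\<^sub>R c) + (s - r) *\<^sub>R c"
        unfolding x cp(3) using 2 by (simp add: min_absorb2 algebra_simps)
      then have "x = min r s *\<^sub>R q + (s - min r s) *\<^sub>R c"
        unfolding q(2) using 2 by (simp add: min_absorb1)
      then show ?thesis using mem(3) q(1) by blast
    next
      case 3
      obtain q where q: "q \<in> ?Q'" "t *\<^sub>R (e + c) + u *\<^sub>R c = (t + u) *\<^sub>R q"
        using coneQ[OF mem(2,1), of t u] t u by auto
      have "x = t *\<^sub>R (e + c) + u *\<^sub>R c"
        unfolding x cp(3) using 3 u by (simp add: min_absorb2 algebra_simps u_def)
      then have "x = min r s *\<^sub>R q + (s - min r s) *\<^sub>R c"
        unfolding q(2) using 3 by (simp add: min_absorb2 u_def)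
      then show ?thesis using mem(3) q(1) by blast
    qed
  qed
qed

text \<open>
  The same inequalities as a list of functionals, so that they can be counted. The scale \<open>s\<close> and
  the accumulated slack \<open>r\<close> are functionals themselves.
\<close>

fun cover_slacks :: "nat \<Rightarrow> nat \<Rightarrow> ((nat \<Rightarrow>\<^sub>0 real) \<Rightarrow> real) \<Rightarrow> ((nat \<Rightarrow>\<^sub>0 real) \<Rightarrow> real)
    \<Rightarrow> ((nat \<Rightarrow>\<^sub>0 real) \<Rightarrow> real) list" where
  "cover_slacks 0 n s r = []"
| "cover_slacks (Suc k) n s r =
    (if n \<le> 2 ^ k then (\<lambda>x. r x - coord k x) # cover_slacks k n s r
     else cover_slacks k (n - 2 ^ k) s (\<lambda>x. r x + (s x - coord k x)))"

lemma length_cover_slacks: "length (cover_slacks k n s r) \<le> k"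
proof (induction k arbitrary: n r)
  case (Suc k)
  show ?case using Suc.IH[of n r] Suc.IH[of "n - 2 ^ k"] by (auto intro: le_SucI)
qed simp

lemma affine_functional_cover_slacks:
  assumes "affine_functional s" "affine_functional r" "h \<in> set (cover_slacks k n s r)"
  shows "affine_functional h"
  using assms(2,3)
proof (induction k arbitrary: n r)
  case (Suc k)
  have 1: "affine_functional (\<lambda>x. r x - coord k x)"
    by (intro affine_functional_diff Suc.prems(1) affine_functional_coord)
  have 2: "affine_functional (\<lambda>x. r x + (s x - coord k x))"
    by (intro affine_functional_add affine_functional_diff Suc.prems(1) affine_functional_coord assms(1))
  show ?case
    using Suc.prems(2) 1 Suc.IH[OF Suc.prems(1), of n] Suc.IH[OF 2, of "n - 2 ^ k"]
    by (auto split: if_splits)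
qed simp

lemma cover_slacks_nonneg_iff:
  "(\<forall>h\<in>set (cover_slacks k n s r). 0 \<le> h x) \<longleftrightarrow> covers k n (s x) (r x) (\<lambda>i. coord i x)"
  by (induction k arbitrary: n r) simp_all

section \<open>Pyramids over lexicographic polytopes\<close>

text \<open>
  Each 0/1 point is a vertex of the cube, so it cannot lie strictly between two points whose
  coordinates are between 0 and 1.
\<close>

lemma extreme_points_convex_hull_zero_one:
  assumes V: "V \<subseteq> zero_one_points m"
  shows "{v. v extreme_point_of convex hull V} = V"
proof (intro equalityI subsetI)
  show "v \<in> V" if "v \<in> {v. v extreme_point_of convex hull V}" for v
    using that extreme_point_of_convex_hull by blast
  fix v assume v: "v \<in> V"
  have box: "0 \<le> coord i x \<and> coord i x \<le> 1" if "x \<in> convex hull V" for i x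
  proof
    have V01: "coord i w = 0 \<or> coord i w = 1" if "w \<in> V" for w
      using that V unfolding zero_one_points_def by (cases "i < m") auto
    show "0 \<le> coord i x"
      by (rule affine_functional_nonneg_on_convex_hull[OF affine_functional_coord _ that])
        (use V01 in force)
    have "0 \<le> 1 - coord i x"
      by (rule affine_functional_nonneg_on_convex_hull[OF _ _ that,
            where h = "\<lambda>x. 1 - coord i x"])
        (use V01 in \<open>force intro: affine_functional_diff affine_functional_const
            affine_functional_coord\<close>)+
    then show "coord i x \<le> 1" by simp
  qed
  have "v \<notin> open_segment a b" if ab: "a \<in> convex hull V" "b \<in> convex hull V" for a b
  proof
    assume "v \<in> open_segment a b"
    then obtain t where t: "a \<noteq> b" "0 < t" "t < 1" "v = (1 - t) *\<^sub>R a + t *\<^sub>R b"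
      by (auto simp: in_segment)
    have "coord i a = coord i b" for i
    proof -
      have vi: "coord i v = (1 - t) * coord i a + t * coord i b" by (simp add: t(4) lookup_add)
      have "coord i v = 0 \<or> coord i v = 1"
        using v V unfolding zero_one_points_def by (cases "i < m") auto
      then show ?thesis
      proof
        assume "coord i v = 0"
        moreover have "0 \<le> (1 - t) * coord i a" "0 \<le> t * coord i b"
          using t box[OF ab(1), of i] box[OF ab(2), of i] by auto
        ultimately have "(1 - t) * coord i a = 0" "t * coord i b = 0" using vi by linarith+
        then show ?thesis using t by simp
      next
        assume "coord i v = 1"
        moreover have "0 \<le> (1 - t) * (1 - coord i a)" "0 \<le> t * (1 - coord i b)"
          using t box[OF ab(1), of i] box[OF ab(2), of i] by auto
        moreover have "(1 - t) * (1 - coord i a) + t * (1 - coord i b) = 1 - coord i v"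
          unfolding vi by (simp add: algebra_simps)
        ultimately have "(1 - t) * (1 - coord i a) = 0" "t * (1 - coord i b) = 0" by linarith+
        then show ?thesis using t by simp
      qed
    qed
    then have "a = b" by (intro poly_mapping_eqI)
    then show False using t(1) by simp
  qed
  then show "v \<in> {v. v extreme_point_of convex hull V}"
    using hull_inc[OF v] by (auto simp: extreme_point_of_def)
qed

text \<open>
  Adding a unit vector in a new direction as a further vertex is the pyramid construction. Here
  it is done \<open>d - k\<close> times.
\<close>

definition pyramid_points :: "nat \<Rightarrow> nat \<Rightarrow> nat \<Rightarrow> (nat \<Rightarrow>\<^sub>0 real) set" where
  "pyramid_points d k n = lex_points k n \<union> unit_vec ` {k..<d}"

text \<open>
  The weight left for the base when the apex coordinates are the weights of the apexes; the
  inequalities of the base are homogenized with it.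
\<close>

definition base_scale :: "nat \<Rightarrow> nat \<Rightarrow> (nat \<Rightarrow>\<^sub>0 real) \<Rightarrow> real" where
  "base_scale d k x = 1 - (\<Sum>j\<in>{k..<d}. coord j x)"

definition pyramid_inequalities :: "nat \<Rightarrow> nat \<Rightarrow> nat \<Rightarrow> ((nat \<Rightarrow>\<^sub>0 real) \<Rightarrow> real) set" where
  "pyramid_inequalities d k n =
    coord ` {..<d} \<union> (\<lambda>i x. base_scale d k x - coord i x) ` {..<k}
      \<union> set (cover_slacks k n (base_scale d k) (\<lambda>x. 0))"

lemma inj_unit_vec: "inj_on unit_vec A"
proof (rule inj_onI)
  fix i j :: nat assume "unit_vec i = unit_vec j"
  then have "coord i (unit_vec i) = coord i (unit_vec j)" by (rule arg_cong)
  then show "i = j" by simp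
qed

lemma pyramid_points_subset:
  assumes "k \<le> d"
  shows "pyramid_points d k n \<subseteq> zero_one_points d"
proof -
  have "zero_one_points k \<subseteq> zero_one_points d"
    using assms by (auto simp: zero_one_points_def) (metis not_le)
  then show ?thesis
    using lex_points_subset[of k n] unfolding pyramid_points_def
    by (auto simp: zero_one_points_def)
qed

lemma finite_pyramid_points: "finite (pyramid_points d k n)"
  by (simp add: pyramid_points_def finite_lex_points)

lemma card_pyramid_points:
  assumes "k \<le> d" "1 \<le> n" "n \<le> 2 ^ k"
  shows "card (pyramid_points d k n) = n + (d - k)"
proof -
  have "unit_vec i \<notin> lex_points k n" if "k \<le> i" for i
  proof
    assume "unit_vec i \<in> lex_points k n"
    then have "coord i (unit_vec i) = 0"
      using lex_points_subset[of k n] that unfolding zero_one_points_def by blast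
    then show False by simp
  qed
  then have "lex_points k n \<inter> unit_vec ` {k..<d} = {}" by auto
  then show ?thesis
    unfolding pyramid_points_def
    using card_Un_disjoint[of "lex_points k n" "unit_vec ` {k..<d}"] card_lex_points[OF assms(2,3)]
    by (simp add: finite_lex_points card_image inj_unit_vec)
qed

lemma affine_functional_base_scale: "affine_functional (base_scale d k)"
  unfolding base_scale_def
  by (intro affine_functional_diff affine_functional_const affine_functional_sum affine_functional_coord)

lemma affine_functional_pyramid_inequalities:
  assumes "h \<in> pyramid_inequalities d k n"
  shows "affine_functional h"
  using assms affine_functional_cover_slacks[OF affine_functional_base_scale affine_functional_const]
  unfolding pyramid_inequalities_def
  by (auto intro: affine_functional_diff affine_functional_base_scale affine_functional_coord)

lemma card_pyramid_inequalities: "card (pyramid_inequalities d k n) \<le> d + 2 * k"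
proof -
  have "card (pyramid_inequalities d k n)
      \<le> card (coord ` {..<d}) + card ((\<lambda>i x. base_scale d k x - coord i x) ` {..<k})
        + card (set (cover_slacks k n (base_scale d k) (\<lambda>x. 0)))"
    unfolding pyramid_inequalities_def by (meson add_le_mono1 card_Un_le le_trans)
  moreover have "card (coord ` {..<d}) \<le> d"
    "card ((\<lambda>i x. base_scale d k x - coord i x) ` {..<k}) \<le> k"
    by (metis card_image_le card_lessThan finite_lessThan)+
  moreover have "card (set (cover_slacks k n (base_scale d k) (\<lambda>x. 0))) \<le> k"
    using card_length length_cover_slacks le_trans by blast
  ultimately show ?thesis by linarith
qed

lemma pyramid_points_satisfy_inequalities:
  assumes "k \<le> d" "v \<in> pyramid_points d k n" "h \<in> pyramid_inequalities d k n"
  shows "0 \<le> h v"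
proof -
  define s where "s = base_scale d k v"
  have "(\<forall>i<k. coord i v \<le> s) \<and> covers k n s 0 (\<lambda>i. coord i v)"
  proof (cases "v \<in> lex_points k n")
    case True
    then have v: "v \<in> zero_one_points k" using lex_points_subset by blast
    then have "s = 1" by (simp add: s_def base_scale_def zero_one_points_def)
    then show ?thesis using v covers_lex_points[OF True] by (auto simp: zero_one_points_def)
  next
    case False
    then obtain j where j: "j \<in> {k..<d}" "v = unit_vec j"
      using assms(2) by (auto simp: pyramid_points_def)
    have "(\<Sum>i\<in>{k..<d}. coord i v) = (\<Sum>i\<in>{k..<d}. if i = j then 1 else 0)"
      by (intro sum.cong) (simp_all add: j(2))
    also have "\<dots> = 1" using j(1) by (simp add: sum.delta)
    finally have "s = 0" by (simp add: s_def base_scale_def)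
    moreover have "coord i v = 0" if "i < k" for i using j that by auto
    ultimately show ?thesis by (simp add: covers_if_slack)
  qed
  then have "covers k n (base_scale d k v) 0 (\<lambda>i. coord i v)" "\<forall>i<k. coord i v \<le> base_scale d k v"
    by (simp_all add: s_def)
  moreover have "0 \<le> coord i v" for i
    using assms(1,2) pyramid_points_subset[of k d n]
    unfolding zero_one_points_def by (cases "i < d") force+
  ultimately show ?thesis
    using assms(3) cover_slacks_nonneg_iff[of k n "base_scale d k" "\<lambda>x. 0" v]
    unfolding pyramid_inequalities_def by auto
qed

text \<open>
  The apex coordinates are the weights of the apexes, and the first \<open>k\<close> coordinates form a point
  of total weight \<open>s\<close> of the cone over the lexicographic polytope. The weight \<open>s\<close> is nonnegative
  because of the two inequalities for coordinate 0, which is a base coordinate as \<open>0 < k\<close>.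
\<close>

lemma pyramid_inequalities_imp_mem:
  assumes k: "0 < k" "k \<le> d" and n: "1 \<le> n" "n \<le> 2 ^ k"
    and x: "\<And>i. d \<le> i \<Longrightarrow> coord i x = 0" "\<And>h. h \<in> pyramid_inequalities d k n \<Longrightarrow> 0 \<le> h x"
  shows "x \<in> convex hull pyramid_points d k n"
proof -
  define s where "s = base_scale d k x"
  define z where "z = x - (\<Sum>j\<in>{k..<d}. coord j x *\<^sub>R unit_vec j)"
  have nonneg: "0 \<le> coord i x" if "i < d" for i
    using x(2)[of "coord i"] that by (simp add: pyramid_inequalities_def)
  have le: "coord i x \<le> s" if "i < k" for i
    using x(2)[of "\<lambda>x. base_scale d k x - coord i x"] that
    by (auto simp: pyramid_inequalities_def s_def)
  have s: "0 \<le> s" using nonneg[of 0] le[of 0] k by auto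
  have "coord i (\<Sum>j\<in>{k..<d}. coord j x *\<^sub>R unit_vec j) = (if i \<in> {k..<d} then coord i x else 0)" for i
  proof -
    have "coord i (\<Sum>j\<in>{k..<d}. coord j x *\<^sub>R unit_vec j)
        = (\<Sum>j\<in>{k..<d}. if j = i then coord i x else 0)"
      by (subst lookup_sum, intro sum.cong) auto
    then show ?thesis by (simp add: sum.delta)
  qed
  then have z: "coord i z = (if i < k then coord i x else 0)" for i
    using x(1)[of i] by (simp add: z_def lookup_minus)
  have "\<forall>h\<in>set (cover_slacks k n (base_scale d k) (\<lambda>x. 0)). 0 \<le> h x"
    using x(2) by (auto simp: pyramid_inequalities_def)
  then have "covers k n s 0 (\<lambda>i. coord i x)"
    using cover_slacks_nonneg_iff[of k n "base_scale d k" "\<lambda>x. 0" x] by (simp add: s_def)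
  then have cov: "covers k n s 0 (\<lambda>i. coord i z)"
    by (subst covers_cong[of k _ "\<lambda>i. coord i x"]) (auto simp: z)
  \<comment> \<open>With \<open>r = 0\<close> the free part of the decomposition disappears.\<close>
  obtain p where p: "p \<in> convex hull lex_points k n" "z = s *\<^sub>R p"
    using lex_points_decomposition[OF s order_refl n _ _ cov] z nonneg le k s
    by (auto simp: min_absorb1)
  \<comment> \<open>The index \<open>d\<close> stands for the base point \<open>p\<close>, the indices \<open>k..<d\<close> for the apexes.\<close>
  define I where "I = insert d {k..<d}"
  define a where "a j = (if j = d then s else coord j x)" for j
  define y where "y j = (if j = d then p else unit_vec j)" for j
  have "(\<Sum>j\<in>I. a j *\<^sub>R y j) \<in> convex hull pyramid_points d k n"
  proof (rule convex_sum)
    have "(\<Sum>j\<in>{k..<d}. a j) = (\<Sum>j\<in>{k..<d}. coord j x)" by (intro sum.cong) (auto simp: a_def)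
    then show "sum a I = 1" by (simp add: I_def) (simp add: a_def s_def base_scale_def)
    show "0 \<le> a i" if "i \<in> I" for i using that nonneg s by (auto simp: a_def I_def)
    have "convex hull lex_points k n \<subseteq> convex hull pyramid_points d k n"
      by (intro hull_mono) (auto simp: pyramid_points_def)
    then have "p \<in> convex hull pyramid_points d k n" using p(1) by blast
    moreover have "unit_vec i \<in> convex hull pyramid_points d k n" if "i \<in> {k..<d}" for i
      using that by (intro hull_inc) (simp add: pyramid_points_def)
    ultimately show "y i \<in> convex hull pyramid_points d k n" if "i \<in> I" for i
      using that by (auto simp: y_def I_def)
  qed (auto simp: I_def)
  moreover have "(\<Sum>j\<in>I. a j *\<^sub>R y j) = x"
  proof -
    have "(\<Sum>j\<in>{k..<d}. a j *\<^sub>R y j) = (\<Sum>j\<in>{k..<d}. coord j x *\<^sub>R unit_vec j)"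
      by (intro sum.cong) (auto simp: a_def y_def)
    then have "(\<Sum>j\<in>I. a j *\<^sub>R y j) = s *\<^sub>R p + (\<Sum>j\<in>{k..<d}. coord j x *\<^sub>R unit_vec j)"
      by (simp add: I_def) (simp add: a_def y_def)
    then show ?thesis by (simp add: p(2)[symmetric] z_def)
  qed
  ultimately show ?thesis by simp
qed

lemma affine_independent_standard:
  "\<not> affine_dependent (insert 0 (unit_vec ` {..<d}))"
proof -
  have "independent (unit_vec ` {..<d})"
    unfolding dependent_def
  proof (rule notI)
    assume "\<exists>a\<in>unit_vec ` {..<d}. a \<in> span (unit_vec ` {..<d} - {a})"
    then obtain i where i: "unit_vec i \<in> span (unit_vec ` {..<d} - {unit_vec i})" by blast
    have "coord i (unit_vec i) = 0"
      by (rule linear_eq_0_on_span[OF linear_coord _ i]) auto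
    then show False by simp
  qed
  then show ?thesis using affine_dependent_imp_dependent2 by blast
qed

lemma affine_hull_standard:
  assumes "insert 0 (unit_vec ` {..<d}) \<subseteq> V" "V \<subseteq> zero_one_points d"
  shows "affine hull V = affine hull (insert 0 (unit_vec ` {..<d}))"
proof
  show "affine hull (insert 0 (unit_vec ` {..<d})) \<subseteq> affine hull V"
    using assms(1) by (rule hull_mono)
  let ?E = "insert 0 (unit_vec ` {..<d})"
  have span: "affine hull ?E = span ?E" by (rule affine_hull_span_0) (simp add: hull_inc)
  have "v \<in> span ?E" if "v \<in> V" for v
  proof -
    have v: "coord i v = 0" if "d \<le> i" for i
      using \<open>v \<in> V\<close> assms(2) that by (auto simp: zero_one_points_def)
    have "v = (\<Sum>j<d. coord j v *\<^sub>R unit_vec j)"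
    proof (rule poly_mapping_eqI)
      fix i
      have "coord i (\<Sum>j<d. coord j v *\<^sub>R unit_vec j) = (\<Sum>j<d. if j = i then coord i v else 0)"
        by (subst lookup_sum, intro sum.cong) auto
      also have "\<dots> = coord i v" using v[of i] by (simp add: sum.delta)
      finally show "coord i v = coord i (\<Sum>j<d. coord j v *\<^sub>R unit_vec j)" by simp
    qed
    moreover have "(\<Sum>j<d. coord j v *\<^sub>R unit_vec j) \<in> span ?E"
      by (intro span_sum span_scale span_base) auto
    ultimately show ?thesis by simp
  qed
  then have "affine hull V \<subseteq> affine hull (affine hull ?E)"
    unfolding span[symmetric] by (intro hull_mono) blast
  then show "affine hull V \<subseteq> affine hull ?E" by (simp add: hull_hull)
qed

text \<open>
  The condition \<open>2 ^ (k - 1) < n\<close> says that the initial segment reaches the points with top bit 1,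
  of which the first is the top unit vector.
\<close>

lemma standard_subset_pyramid_points:
  assumes "0 < k" "k \<le> d" "2 ^ (k - 1) < n"
  shows "insert 0 (unit_vec ` {..<d}) \<subseteq> pyramid_points d k n"
proof -
  have "unit_vec i \<in> lex_points k n" if "i < k" for i
    using unit_vec_mem_lex_points[OF assms(3), of i] that assms(1) by simp
  then have "unit_vec i \<in> pyramid_points d k n" if "i < d" for i
    using that by (cases "i < k") (simp_all add: pyramid_points_def)
  moreover have "0 \<in> pyramid_points d k n"
    by (simp add: pyramid_points_def zero_mem_lex_points)
  ultimately show ?thesis by blast
qed

lemma pyramid_polytope:
  assumes k: "0 < k" "k \<le> d" and n: "2 ^ (k - 1) < n" "n \<le> 2 ^ k"
  defines "P \<equiv> convex hull pyramid_points d k n"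
  shows "zero_one_polytope d P" "affine_dim P = int d"
    "card {v. v extreme_point_of P} = n + (d - k)"
    "card {F. is_facet_of F P} \<le> d + 2 * k"
proof -
  let ?V = "pyramid_points d k n" and ?E = "insert 0 (unit_vec ` {..<d})"
  note sub = pyramid_points_subset[OF k(2), of n]
  note aff = affine_hull_standard[OF standard_subset_pyramid_points[OF k n(1)] sub]
  have n1: "1 \<le> n" using n(1) by (metis One_nat_def Suc_leI gr_implies_not0 neq0_conv)
  show "zero_one_polytope d P" using sub unfolding zero_one_polytope_def P_def by blast
  have "0 \<notin> unit_vec ` {..<d}"
  proof
    assume "0 \<in> unit_vec ` {..<d}"
    then obtain i where "unit_vec i = 0" by auto
    then have "coord i (unit_vec i) = coord i 0" by (rule arg_cong)
    then show False by simp
  qed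
  then have "card ?E = d + 1" by (simp add: card_image inj_unit_vec)
  then show "affine_dim P = int d"
    using affine_dim_eq_card[OF _ affine_independent_standard aff[symmetric]]
    by (simp add: P_def affine_dim_convex_hull)
  show "card {v. v extreme_point_of P} = n + (d - k)"
    unfolding P_def extreme_points_convex_hull_zero_one[OF sub]
    by (rule card_pyramid_points[OF k(2) n1 n(2)])
  have fin: "finite (pyramid_inequalities d k n)" by (simp add: pyramid_inequalities_def)
  have eq: "P = {x \<in> affine hull ?V. \<forall>h\<in>pyramid_inequalities d k n. 0 \<le> h x}"
  proof (intro equalityI subsetI)
    fix x assume x: "x \<in> P"
    have "0 \<le> h x" if h: "h \<in> pyramid_inequalities d k n" for h
      by (rule affine_functional_nonneg_on_convex_hull[OF affine_functional_pyramid_inequalities[OF h] _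
            x[unfolded P_def]]) (rule pyramid_points_satisfy_inequalities[OF k(2) _ h])
    then show "x \<in> {x \<in> affine hull ?V. \<forall>h\<in>pyramid_inequalities d k n. 0 \<le> h x}"
      using x convex_hull_subset_affine_hull unfolding P_def by blast
  next
    fix x assume x: "x \<in> {x \<in> affine hull ?V. \<forall>h\<in>pyramid_inequalities d k n. 0 \<le> h x}"
    then have "x \<in> affine hull ?V" by blast
    then have "coord i x = 0" if "d \<le> i" for i
      by (rule affine_functional_eq_on_affine_hull[OF affine_functional_coord affine_functional_const,
            rotated]) (use sub that in \<open>auto simp: zero_one_points_def\<close>)
    then show "x \<in> P" unfolding P_def
      using x by (intro pyramid_inequalities_imp_mem[OF k n1 n(2)]) auto
  qed
  have "card {F. is_facet_of F P} \<le> card (pyramid_inequalities d k n)"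
    unfolding P_def
    by (rule card_facets_le_card_inequalities[OF finite_pyramid_points fin
          affine_functional_pyramid_inequalities eq[unfolded P_def]])
  then show "card {F. is_facet_of F P} \<le> d + 2 * k"
    using card_pyramid_inequalities[of d k n] by linarith
qed

text \<open>
  Building \<open>d - k\<close> pyramids over a base of dimension \<open>k\<close> with \<open>n - (d - k)\<close> vertices uses up
  the excess of dimension at the price of one facet each. The smallest \<open>k\<close> for which this many
  vertices fit into the \<open>k\<close>-cube is best; its minimality also makes the base full-dimensional, since
  the vertices would not fit into the \<open>(k - 1)\<close>-cube. For \<open>k = 1\<close> the base is a segment.
  Every \<open>c\<close> with \<open>n \<le> 2 ^ c\<close> bounds \<open>k\<close>, which amounts to \<open>k \<le> \<lceil>log 2 n\<rceil>\<close>.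
\<close>

lemma zero_one_polytope_exists:
  assumes d: "0 < d" "d + 1 \<le> n" "n \<le> 2 ^ d"
  obtains k P where "k \<le> d" "\<And>c. 0 < c \<Longrightarrow> n \<le> 2 ^ c \<Longrightarrow> k \<le> c"
    "zero_one_polytope d P" "affine_dim P = int d" "card {v. v extreme_point_of P} = n"
    "card {F. is_facet_of F P} \<le> d + 2 * k"
proof -
  define k where "k = (LEAST k. 0 < k \<and> n + k \<le> 2 ^ k + d)"
  have ex: "0 < d \<and> n + d \<le> 2 ^ d + d" using d by simp
  have k: "0 < k" "n + k \<le> 2 ^ k + d" "k \<le> d"
    using LeastI[of "\<lambda>k. 0 < k \<and> n + k \<le> 2 ^ k + d", OF ex]
      Least_le[of "\<lambda>k. 0 < k \<and> n + k \<le> 2 ^ k + d", OF ex] by (auto simp: k_def)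
  have least: "k \<le> c" if "0 < c" "n + c \<le> 2 ^ c + d" for c
    unfolding k_def using that by (intro Least_le) simp
  define n' where "n' = n - (d - k)"
  have n': "n' \<le> 2 ^ k" "n' + (d - k) = n" using k d by (auto simp: n'_def)
  have big: "2 ^ (k - 1) < n'"
  proof (cases "k = 1")
    case True
    then show ?thesis using d k by (simp add: n'_def)
  next
    case False
    then have "\<not> n + (k - 1) \<le> 2 ^ (k - 1) + d" using least[of "k - 1"] k by fastforce
    then show ?thesis using k by (simp add: n'_def)
  qed
  have "k \<le> c" if c: "0 < c" "n \<le> 2 ^ c" for c
  proof (cases "c \<le> d")
    case True
    then show ?thesis using least[of c] c by simp
  qed (use k in simp)
  then show ?thesis
    using that[of k "convex hull pyramid_points d k n'"] k(3) n'(2)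
      pyramid_polytope[OF k(1,3) big n'(1)] by simp
qed

section \<open>Bounds on the minimal number of facets\<close>

lemma g_nfac_le:
  assumes "zero_one_polytope m P" "affine_dim P = int d" "card {v. v extreme_point_of P} = n"
  shows "g_nfac d n \<le> card {F. is_facet_of F P}"
  unfolding g_nfac_def using assms by (intro Least_le) blast

lemma g_nfac_upper:
  assumes d: "0 < d" "d + 1 \<le> n" "n \<le> 2 ^ d"
  shows "g_nfac d n \<le> 3 * d" "real (g_nfac d n) \<le> real d + 2 * log 2 (real n) + 2"
proof -
  obtain k P where k: "k \<le> d" "\<And>c. 0 < c \<Longrightarrow> n \<le> 2 ^ c \<Longrightarrow> k \<le> c"
    and P: "zero_one_polytope d P" "affine_dim P = int d" "card {v. v extreme_point_of P} = n"
      "card {F. is_facet_of F P} \<le> d + 2 * k"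
    using zero_one_polytope_exists[OF d] by blast
  have g: "g_nfac d n \<le> d + 2 * k" using g_nfac_le[OF P(1-3)] P(4) by linarith
  then show "g_nfac d n \<le> 3 * d" using k(1) by linarith
  define c where "c = nat \<lceil>log 2 (real n)\<rceil>"
  have n2: "2 \<le> n" using d by simp
  then have l: "1 \<le> log 2 (real n)" by (simp add: le_log_iff)
  then have c: "log 2 (real n) \<le> real c" "real c \<le> log 2 (real n) + 1" "0 < c"
    unfolding c_def by linarith+
  have "real n = 2 powr log 2 (real n)" using n2 by simp
  also have "\<dots> \<le> 2 powr real c" using c(1) by (intro powr_mono) auto
  also have "\<dots> = real (2 ^ c)" by (simp add: powr_realpow)
  finally have "n \<le> 2 ^ c" by (simp only: of_nat_le_iff)
  then have "k \<le> c" using k(2) c(3) by blast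
  then show "real (g_nfac d n) \<le> real d + 2 * log 2 (real n) + 2" using g c(2) by linarith
qed

text \<open>
  The minimum is attained, because the set of possible facet numbers is nonempty, and every
  polytope satisfies the bound.
\<close>

lemma g_nfac_lower:
  assumes d: "0 < d" "d + 1 \<le> n" "n \<le> 2 ^ d"
  shows "d + 1 \<le> g_nfac d n"
proof -
  obtain P where P: "zero_one_polytope d P" "affine_dim P = int d" "card {v. v extreme_point_of P} = n"
    using zero_one_polytope_exists[OF d] by metis
  define attained where "attained k \<longleftrightarrow> (\<exists>m P. zero_one_polytope m P \<and> affine_dim P = int d
      \<and> card {v. v extreme_point_of P} = n \<and> card {F. is_facet_of F P} = k)" for k
  have "attained (card {F. is_facet_of F P})" unfolding attained_def using P by blast
  then have "attained (g_nfac d n)"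
    unfolding g_nfac_def attained_def[symmetric] by (rule LeastI)
  then obtain m Q where Q: "zero_one_polytope m Q" "affine_dim Q = int d"
      "card {F. is_facet_of F Q} = g_nfac d n"
    unfolding attained_def by blast
  then obtain V where V: "V \<subseteq> zero_one_points m" "Q = convex hull V"
    unfolding zero_one_polytope_def by blast
  have "finite V" using V(1) finite_zero_one_points by (rule finite_subset)
  then show ?thesis using card_facets_ge_dim_plus_one[of V d] Q V(2) d(1) by simp
qed

theorem theorem6:
  shows "(\<forall>d n :: nat. 0 < d \<and> 0 < n \<and> d + 1 \<le> n \<and> n \<le> 2 ^ d \<longrightarrow> g_nfac d n \<le> 3 * d)
    \<and> (\<forall>n :: nat \<Rightarrow> nat.
          (\<forall>d>0. d + 1 \<le> n d \<and> n d \<le> 2 ^ d) \<and>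
          (\<lambda>d. log 2 (real (n d))) \<in> o(\<lambda>d. real d) \<longrightarrow>
          (\<lambda>d. real (g_nfac d (n d)) - real d) \<in> o(\<lambda>d. real d))
    \<and> (\<forall>\<alpha> :: real. 1 < \<alpha> \<and> \<alpha> < 2 \<longrightarrow>
          (\<exists>h :: nat \<Rightarrow> real. h \<in> o(\<lambda>d. real d) \<and>
             (\<forall>\<^sub>F d in sequentially.
                real (g_nfac d (nat \<lfloor>\<alpha> ^ d\<rfloor>)) \<le> (1 + 2 * log 2 \<alpha>) * real d + h d)))"
proof (intro conjI allI impI)
  show "g_nfac d n \<le> 3 * d" if "0 < d \<and> 0 < n \<and> d + 1 \<le> n \<and> n \<le> 2 ^ d" for d n
    using g_nfac_upper(1) that by blast
next
  fix n :: "nat \<Rightarrow> nat"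
  assume *: "(\<forall>d>0. d + 1 \<le> n d \<and> n d \<le> 2 ^ d) \<and>
          (\<lambda>d. log 2 (real (n d))) \<in> o(\<lambda>d. real d)"
  have "(\<lambda>d. 2 * log 2 (real (n d)) + 2) \<in> o(\<lambda>d. real d)"
  proof (rule sum_in_smallo)
    show "(\<lambda>d. 2 * log 2 (real (n d))) \<in> o(\<lambda>d. real d)" using * by simp
    show "(\<lambda>d. 2 :: real) \<in> o(\<lambda>d. real d)" by real_asymp
  qed
  moreover have bound: "\<forall>\<^sub>F d in sequentially.
      norm (real (g_nfac d (n d)) - real d) \<le> 1 * norm (2 * log 2 (real (n d)) + 2)"
    using eventually_gt_at_top[of 0]
  proof eventually_elim
    case (elim d)
    then have n: "0 < d" "d + 1 \<le> n d" "n d \<le> 2 ^ d" using * by auto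
    show ?case using g_nfac_upper(2)[OF n] g_nfac_lower[OF n] by simp
  qed
  ultimately show "(\<lambda>d. real (g_nfac d (n d)) - real d) \<in> o(\<lambda>d. real d)"
    using landau_o.big_small_trans[OF bigoI[OF bound]] by blast
next
  fix \<alpha> :: real
  assume \<alpha>: "1 < \<alpha> \<and> \<alpha> < 2"
  have "\<forall>\<^sub>F d in sequentially. real d + 2 \<le> \<alpha> ^ d" using \<alpha> by real_asymp
  then have "\<forall>\<^sub>F d in sequentially.
      real (g_nfac d (nat \<lfloor>\<alpha> ^ d\<rfloor>)) \<le> (1 + 2 * log 2 \<alpha>) * real d + 2"
    using eventually_gt_at_top[of 0]
  proof eventually_elim
    case (elim d)
    define n where "n = nat \<lfloor>\<alpha> ^ d\<rfloor>"
    have n_le: "real n \<le> \<alpha> ^ d" using \<alpha> by (simp add: n_def)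
    note n_le
    also have "\<alpha> ^ d \<le> 2 ^ d" using \<alpha> by (intro power_mono) auto
    finally have "real n \<le> real (2 ^ d)" by simp
    then have "n \<le> 2 ^ d" by (simp only: of_nat_le_iff)
    moreover have dn: "d + 1 \<le> n" using elim(1) unfolding n_def by linarith
    ultimately have "real (g_nfac d n) \<le> real d + 2 * log 2 (real n) + 2"
      using g_nfac_upper(2) elim(2) by blast
    moreover have "log 2 (real n) \<le> log 2 (\<alpha> ^ d)" using n_le dn by simp
    moreover have "log 2 (\<alpha> ^ d) = real d * log 2 \<alpha>" using \<alpha> by (simp add: log_nat_power)
    ultimately show ?case by (simp add: n_def algebra_simps)
  qed
  moreover have "(\<lambda>d. 2 :: real) \<in> o(\<lambda>d. real d)" by real_asymp
  ultimately show "\<exists>h :: nat \<Rightarrow> real. h \<in> o(\<lambda>d. real d) \<and>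
      (\<forall>\<^sub>F d in sequentially.
        real (g_nfac d (nat \<lfloor>\<alpha> ^ d\<rfloor>)) \<le> (1 + 2 * log 2 \<alpha>) * real d + h d)"
    by blast
qed

end
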